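(* Let $t$ be a positive integer and let $q$ be a prime power. For $q \geqslant (t-1)!+1$ the norm graph $\Gamma(t)$ over $\mathbb{F}_q$ contains no copy of $K_{t+1,(t-1)!-1}$.
   Context: Let $q$ be a prime power and let $\mathbb{F}_{q^k}$ denote the finite field with $q^k$ elements. For $a\in\mathbb{F}_{q^{t-1}}$ put $N(a)=a^{1+q+\cdots+q^{t-2}}\in\mathbb{F}_q$ (the norm from $\mathbb{F}_{q^{t-1}}$ to $\mathbb{F}_q$). The norm graph $\Gamma(t)$ has as vertices all pairs $(a,\alpha)\in\mathbb{F}_{q^{t-1}}\times\mathbb{F}_q$ with $\alpha\neq 0$; the vertex $(a,\alpha)$ is joined to $(a',\alpha')$ if and only if $N(a+a')=\alpha\alpha'$. $K_{r,s}$ denotes the complete bipartite graph with $r$ vertices in one class and $s$ vertices in the other. A graph contains a copy of $K_{r,s}$ if it has a (not necessarily induced) subgraph isomorphic to $K_{r,s}$, i.e. there are disjoint sets of $r$ and $s$ distinct vertices such that every vertex of the first set is adjacent to every vertex of the second.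
   Formalization: Proved for t ≥ 4 instead of all positive integers t: for t = 1 the field F_{q^0} does not exist, for t = 2 (q ≥ 3) the graph contains K_{3,0}, and for t = 3 every vertex has at least four neighbours, so K_{4,1} occurs. *)

theory Defs
  imports
    "HOL-Library.Cardinality"
    "HOL-Algebra.Algebraic_Closure_Type"
    "HOL-Number_Theory.Prime_Powers"
    "Graph_Theory.Graph_Theory"
begin

(* The field with q^(t-1) elements is a type 'a of class field with CARD('a) = q^(t-1);
   the field with q elements is a subfield F of it, in the sense of HOL-Algebra's subfield
   (applied to ring_of_type_algebra, which is the type 'a viewed as a ring record). *)

text \<open>The exponent is \<open>1 + q + \<dots> + q^(t-2)\<close>.\<close>

definition norm_map :: "nat \<Rightarrow> nat \<Rightarrow> 'a::field \<Rightarrow> 'a" where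
  "norm_map q t a = a ^ (\<Sum>i<t - 1. q ^ i)"

text \<open>
  An undirected graph is represented, as usual in Graph\_Theory, by a digraph with a symmetric set
  of arcs. The adjacency rule may join a vertex to itself; such loops are irrelevant below, because
  the two classes of a complete bipartite graph are disjoint.
\<close>

definition norm_graph :: "'a::field set \<Rightarrow> nat \<Rightarrow> nat \<Rightarrow> ('a \<times> 'a) pair_pre_digraph" where
  "norm_graph F q t =
    \<lparr> pverts = UNIV \<times> (F - {0}),
      parcs = {((a, \<alpha>), (a', \<alpha>')) | a \<alpha> a' \<alpha>'.
                 \<alpha> \<in> F - {0} \<and> \<alpha>' \<in> F - {0} \<and> norm_map q t (a + a') = \<alpha> * \<alpha>'} \<rparr>"

definition contains_complete_bipartite :: "nat \<Rightarrow> nat \<Rightarrow> 'v pair_pre_digraph \<Rightarrow> bool" where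
  "contains_complete_bipartite r s G \<longleftrightarrow>
     (\<exists>H :: 'v pair_pre_digraph. subgraph (with_proj H) (with_proj G) \<and>
        complete_bipartite_digraph r s (with_proj H))"

lemma wf_norm_graph: "wf_digraph (with_proj (norm_graph F q t))"
  by unfold_locales (auto simp: norm_graph_def)

lemma sym_norm_graph: "sym (parcs (norm_graph F q t))"
  by (auto simp: norm_graph_def sym_def add.commute mult.commute)

lemma contains_complete_bipartite_iff:
  assumes "wf_digraph (with_proj G)" and "sym (parcs G)"
  shows "contains_complete_bipartite r s G \<longleftrightarrow>
    (\<exists>A B. A \<subseteq> pverts G \<and> B \<subseteq> pverts G \<and> finite A \<and> finite B \<and> A \<inter> B = {} \<and>
           card A = r \<and> card B = s \<and> A \<times> B \<subseteq> parcs G)"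
    (is "_ \<longleftrightarrow> ?R")
proof
  assume "contains_complete_bipartite r s G"
  then obtain H A B where H: "subgraph (with_proj H) (with_proj G)"
    and AB: "finite (pverts H)" "pverts H = A \<union> B" "A \<inter> B = {}" "card A = r" "card B = s"
      "parcs H = A \<times> B \<union> B \<times> A"
    unfolding contains_complete_bipartite_def complete_bipartite_digraph_pair_def by blast
  have "pverts H \<subseteq> pverts G" "parcs H \<subseteq> parcs G"
    using H by (simp_all add: subgraph_def)
  then show ?R
    using AB by (intro exI[of _ A] exI[of _ B]) simp
next
  assume ?R
  then obtain A B where AB: "A \<subseteq> pverts G" "B \<subseteq> pverts G" "finite A" "finite B" "A \<inter> B = {}"
    "card A = r" "card B = s" "A \<times> B \<subseteq> parcs G" by blast
  define H where "H = \<lparr> pverts = A \<union> B, parcs = A \<times> B \<union> B \<times> A \<rparr>"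
  have "wf_digraph (with_proj H)"
    by unfold_locales (auto simp: H_def)
  moreover have "B \<times> A \<subseteq> parcs G"
    using AB(8) assms(2) by (auto dest: symD)
  ultimately have "subgraph (with_proj H) (with_proj G)"
    using AB assms(1) by (auto simp: subgraph_def H_def compatible_def)
  moreover have "complete_bipartite_digraph r s (with_proj H)"
    unfolding complete_bipartite_digraph_pair_def using AB by (auto simp: H_def)
  ultimately show "contains_complete_bipartite r s G"
    unfolding contains_complete_bipartite_def by blast
qed

text \<open>
  The theorem on \<open>K\<^bsub>t+1,(t-1)!-1\<^esub>\<close> needs \<open>t \<ge> 4\<close>: for \<open>t = 2\<close> the second class is empty, so that any
  three vertices form a copy, and for \<open>t = 3\<close> it says that no vertex has four neighbours. For \<open>t = 1\<close>
  there is no field with \<open>q^(t-1)\<close> elements.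
\<close>

lemma norm_graph_2_contains:
  fixes F :: "'a::{field,finite} set"
  assumes "card F \<ge> 3"
  shows "contains_complete_bipartite (2 + 1) (fact (2 - 1) - 1) (norm_graph F q 2)"
proof -
  have "card (F - {0}) \<ge> 2"
    using assms by (cases "0 \<in> F") (auto simp: card_Diff_singleton_if)
  moreover have "card (UNIV :: 'a set) \<ge> 3"
    using assms card_mono[of UNIV F] by simp
  ultimately have "3 * 2 \<le> card (UNIV :: 'a set) * card (F - {0})"
    by (rule mult_le_mono[rotated])
  then have "3 \<le> card ((UNIV :: 'a set) \<times> (F - {0}))"
    by (simp add: card_cartesian_product)
  then obtain A where "A \<subseteq> (UNIV :: 'a set) \<times> (F - {0})" "card A = 3"
    by (elim obtain_subset_with_card_n) blast
  then show ?thesis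
    unfolding contains_complete_bipartite_iff[OF wf_norm_graph sym_norm_graph]
    by (intro exI[of _ A] exI[of _ "{}"]) (auto simp: norm_graph_def)
qed

lemma norm_graph_3_contains:
  fixes F :: "'a::{field,finite} set"
  assumes F: "subfield F (ring_of_type_algebra :: 'a ring)" and "card F \<ge> 5"
  shows "contains_complete_bipartite (3 + 1) (fact (3 - 1) - 1) (norm_graph F q 3)"
proof -
  interpret subfield F "ring_of_type_algebra :: 'a ring" by (fact F)
  have mult: "x * y \<in> F" if "x \<in> F" "y \<in> F" for x y
    using m_closed that by (auto simp: ring_of_type_algebra_def)
  have one: "1 \<in> F"
    using one_closed by (simp add: ring_of_type_algebra_def)
  have pow: "x ^ n \<in> F" if "x \<in> F" for x n
    using that by (induction n) (auto simp: one mult)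
  have "card (F - {0}) \<ge> 4"
    using assms(2) by (cases "0 \<in> F") (auto simp: card_Diff_singleton_if)
  then obtain S where S: "S \<subseteq> F - {0}" "card S = 4"
    by (elim obtain_subset_with_card_n) blast
  define A where "A = (\<lambda>a. (a, norm_map q 3 a)) ` S"
  have "card A = 4"
    using S(2) by (simp add: A_def card_image inj_on_def)
  then show ?thesis
    unfolding contains_complete_bipartite_iff[OF wf_norm_graph sym_norm_graph]
    using S(1)
    by (intro exI[of _ A] exI[of _ "{(0, 1)}"])
       (auto simp: A_def norm_graph_def norm_map_def pow one fact_numeral)
qed

end

theory Submission
  imports Defs "HOL-Number_Theory.Residues"
begin

text \<open>
  Put \<open>n = t - 1\<close>, let \<open>K\<close> be the field with \<open>q^n\<close> elements and suppose that
  \<open>(a\<^sub>0, \<alpha>\<^sub>0), \<dots>, (a\<^sub>n\<^sub>+\<^sub>1, \<alpha>\<^sub>n\<^sub>+\<^sub>1)\<close> have many common neighbours \<open>(b, \<beta>)\<close>. Substituting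
  \<open>y = 1 / (b + a\<^sub>0)\<close> turns adjacency into \<open>n + 1\<close> equations \<open>N(y + c\<^sub>j) = \<gamma>\<^sub>j\<close> with distinct \<open>c\<^sub>j\<close>,
  and with \<open>x\<^sub>i = y^(q^i)\<close> they become \<open>f\<^sub>j(x) = (\<Prod>i<n. x\<^sub>i + c\<^sub>j^(q^i)) - \<gamma>\<^sub>j = 0\<close>. Let \<open>B\<close> be the space of
  polynomials of degree at most \<open>i\<close> in \<open>x\<^sub>i\<close> (\<open>i < n\<close>), of dimension \<open>n!\<close>, and \<open>B'\<close> the one with degrees at most
  \<open>i + 1\<close>, of dimension \<open>(n + 1)!\<close>. The \<open>n + 1\<close> products generate \<open>B'\<close> over \<open>B\<close>, freely because the dimensions
  match. Hence every function on the solution set \<open>Y\<close> is the restriction of an element of \<open>B\<close>, while the elements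
  of \<open>B'\<close> vanishing on \<open>Y\<close> contain the direct sum \<open>f\<^sub>0 B + \<dots> + f\<^sub>n\<^sub>-\<^sub>1 B\<close> of dimension \<open>n n!\<close>.

  If \<open>Y\<close> had at least \<open>n! - 1\<close> elements, then this sum would have codimension at most one in the space of
  vanishing elements, so it would contain a nonzero multiple \<open>(\<mu> + \<nu> x\<^sub>i) f\<^sub>n\<close> for \<open>i = n - 1\<close> and for
  \<open>i = n - 2\<close>. Comparing the two representations makes \<open>f\<^sub>n\<close> a linear combination of \<open>f\<^sub>0, \<dots>, f\<^sub>n\<^sub>-\<^sub>1\<close> with constant
  coefficients. Such a dependency forces the ratios \<open>(c\<^sub>j - c\<^sub>n) / (c\<^sub>k - c\<^sub>n)\<close> to be fixed by the Frobenius map,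
  and then the equations determine the characteristic polynomial of (a rescaling of) \<open>y\<close>, which leaves at most
  \<open>n < n! - 1\<close> solutions.
\<close>

section \<open>Functions that are polynomial in each variable\<close>

text \<open>
  All degrees that occur are smaller than the size of the field, so polynomials can be identified with the functions
  they induce. The first condition is not implied by the second one, because there are infinitely many variables.
\<close>

definition polyfun :: "(nat \<Rightarrow> nat) \<Rightarrow> ((nat \<Rightarrow> 'a) \<Rightarrow> 'a::field) set" where
  "polyfun d = {p. (\<forall>x y. (\<forall>i. 0 < d i \<longrightarrow> x i = y i) \<longrightarrow> p x = p y) \<and>
     (\<forall>i x. \<exists>u. degree u \<le> d i \<and> (\<forall>t. p (x(i := t)) = poly u t))}"

lemma polyfun_cong: "p \<in> polyfun d \<Longrightarrow> (\<And>i. 0 < d i \<Longrightarrow> x i = y i) \<Longrightarrow> p x = p y"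
  unfolding polyfun_def by blast

lemma polyfun_slice:
  assumes "p \<in> polyfun d"
  obtains u where "degree u \<le> d i" "\<And>t. p (x(i := t)) = poly u t"
  using assms unfolding polyfun_def by blast

lemma polyfun_mono:
  assumes "p \<in> polyfun d" "\<And>i. d i \<le> d' i"
  shows "p \<in> polyfun d'"
proof -
  have "p x = p y" if "\<forall>i. 0 < d' i \<longrightarrow> x i = y i" for x y
    using polyfun_cong[OF assms(1), of x y] that assms(2) by (meson less_le_trans)
  moreover have "\<exists>u. degree u \<le> d' i \<and> (\<forall>t. p (x(i := t)) = poly u t)" for i x
    using polyfun_slice[OF assms(1), of i x] assms(2)[of i] by (metis le_trans)
  ultimately show ?thesis
    unfolding polyfun_def by blast
qed

lemma polyfun_const [simp]: "(\<lambda>x. a) \<in> polyfun d"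
  unfolding polyfun_def by (auto intro!: exI[of _ "[:a:]"])

lemma polyfun_add:
  assumes "p \<in> polyfun d" "r \<in> polyfun d"
  shows "(\<lambda>x. p x + r x) \<in> polyfun d"
proof -
  have "p x + r x = p y + r y" if "\<forall>i. 0 < d i \<longrightarrow> x i = y i" for x y
    using polyfun_cong[OF assms(1), of x y] polyfun_cong[OF assms(2), of x y] that by simp
  moreover have "\<exists>u. degree u \<le> d i \<and> (\<forall>t. p (x(i := t)) + r (x(i := t)) = poly u t)" for i x
    using polyfun_slice[OF assms(1), of i x] polyfun_slice[OF assms(2), of i x]
    by (metis degree_add_le poly_add)
  ultimately show ?thesis
    unfolding polyfun_def by blast
qed

lemma polyfun_mult:
  assumes "p \<in> polyfun d" "r \<in> polyfun e"
  shows "(\<lambda>x. p x * r x) \<in> polyfun (\<lambda>i. d i + e i)"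
proof -
  have "p x * r x = p y * r y" if "\<forall>i. 0 < d i + e i \<longrightarrow> x i = y i" for x y
    using polyfun_cong[OF assms(1), of x y] polyfun_cong[OF assms(2), of x y] that by simp
  moreover have "\<exists>u. degree u \<le> d i + e i \<and> (\<forall>t. p (x(i := t)) * r (x(i := t)) = poly u t)" for i x
  proof -
    obtain u v where "degree u \<le> d i" "\<And>t. p (x(i := t)) = poly u t"
      and "degree v \<le> e i" "\<And>t. r (x(i := t)) = poly v t"
      using polyfun_slice[OF assms(1), of i x] polyfun_slice[OF assms(2), of i x] by metis
    then show ?thesis
      by (intro exI[of _ "u * v"]) (auto intro: order_trans[OF degree_mult_le])
  qed
  ultimately show ?thesis
    unfolding polyfun_def by blast
qed

lemma polyfun_mult':
  assumes "p \<in> polyfun d" "r \<in> polyfun e" "\<And>i. d i + e i \<le> f i"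
  shows "(\<lambda>x. p x * r x) \<in> polyfun f"
  using polyfun_mono[OF polyfun_mult[OF assms(1,2)]] assms(3) by blast

lemma polyfun_cmult: "p \<in> polyfun d \<Longrightarrow> (\<lambda>x. a * p x) \<in> polyfun d"
  using polyfun_mult'[OF polyfun_const[of a "\<lambda>_. 0"], of p d d] by simp

lemma polyfun_diff:
  assumes "p \<in> polyfun d" "r \<in> polyfun d"
  shows "(\<lambda>x. p x - r x) \<in> polyfun d"
  using polyfun_add[OF assms(1) polyfun_cmult[OF assms(2), of "-1"]] by simp

lemma polyfun_sum:
  assumes "\<And>j. j \<in> J \<Longrightarrow> p j \<in> polyfun d"
  shows "(\<lambda>x. \<Sum>j\<in>J. p j x) \<in> polyfun d"
  using assms by (induction J rule: infinite_finite_induct) (auto intro: polyfun_add)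

lemma polyfun_poly:
  assumes "degree u \<le> d i"
  shows "(\<lambda>x. poly u (x i)) \<in> polyfun d"
proof -
  have "poly u (x i) = poly u (y i)" if "\<forall>i. 0 < d i \<longrightarrow> x i = y i" for x y
  proof (cases "d i = 0")
    case True
    with assms obtain a where "u = [:a:]"
      by (metis degree_eq_zeroE le_zero_eq)
    then show ?thesis by simp
  qed (use that in simp)
  moreover have "\<exists>v. degree v \<le> d k \<and> (\<forall>t. poly u ((x(k := t)) i) = poly v t)" for k x
  proof (cases "k = i")
    case True
    then show ?thesis using assms by auto
  next
    case False
    then show ?thesis by (intro exI[of _ "[:poly u (x i):]"]) auto
  qed
  ultimately show ?thesis
    unfolding polyfun_def by blast
qed

lemma polyfun_mult_poly:
  assumes "p \<in> polyfun d" "degree u + d i \<le> e i" "\<And>k. k \<noteq> i \<Longrightarrow> d k \<le> e k"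
  shows "(\<lambda>x. p x * poly u (x i)) \<in> polyfun e"
  by (rule polyfun_mult'[OF assms(1) polyfun_poly[of u "(\<lambda>_. 0)(i := degree u)"]])
     (use assms(2,3) in \<open>auto simp: add.commute\<close>)

lemma polyfun_eval:
  assumes "p \<in> polyfun d"
  shows "(\<lambda>x. p (x(i := a))) \<in> polyfun (d(i := 0))"
proof -
  have "p (x(i := a)) = p (y(i := a))" if "\<forall>k. 0 < (d(i := 0)) k \<longrightarrow> x k = y k" for x y
    by (rule polyfun_cong[OF assms]) (use that in auto)
  moreover have "\<exists>u. degree u \<le> (d(i := 0)) k \<and> (\<forall>t. p (x(k := t, i := a)) = poly u t)" for k x
  proof (cases "k = i")
    case True
    then show ?thesis by (intro exI[of _ "[:p (x(i := a)):]"]) auto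
  next
    case False
    obtain u where "degree u \<le> d k" "\<And>t. p (x(i := a, k := t)) = poly u t"
      using polyfun_slice[OF assms] by blast
    then show ?thesis
      using False by (intro exI[of _ u]) (simp add: fun_upd_twist)
  qed
  ultimately show ?thesis
    unfolding polyfun_def by blast
qed

section \<open>Interpolation in one variable and dimension counting\<close>

lemma lagrange_interpolation:
  fixes u :: "'a::field poly" and \<tau> :: "'b \<Rightarrow> 'a"
  assumes "finite J" "inj_on \<tau> J" "degree u < card J"
  shows "u = (\<Sum>k\<in>J. smult (poly u (\<tau> k)) (\<Prod>l\<in>J - {k}. smult (inverse (\<tau> k - \<tau> l)) [:- \<tau> l, 1:]))"
    (is "u = ?v")
proof (rule poly_eqI_degree[of "\<tau> ` J"])
  have ne: "J \<noteq> {}" using assms(3) by auto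
  have "degree (\<Prod>l\<in>J - {k}. smult (inverse (\<tau> k - \<tau> l)) [:- \<tau> l, 1:]) < card J" if "k \<in> J" for k
  proof -
    have "degree (\<Prod>l\<in>J - {k}. smult (inverse (\<tau> k - \<tau> l)) [:- \<tau> l, 1:])
        \<le> (\<Sum>l\<in>J - {k}. degree (smult (inverse (\<tau> k - \<tau> l)) [:- \<tau> l, 1:]))"
      using degree_prod_sum_le[of "J - {k}" "\<lambda>l. smult (inverse (\<tau> k - \<tau> l)) [:- \<tau> l, 1:]"] assms(1)
      by (simp add: o_def)
    also have "\<dots> \<le> (\<Sum>l\<in>J - {k}. 1)"
      by (intro sum_mono order_trans[OF degree_smult_le]) simp
    also have "\<dots> < card J"
      using that assms(1,3) by simp
    finally show ?thesis .
  qed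
  then show "degree ?v < card (\<tau> ` J)"
    unfolding card_image[OF assms(2)] using assms(1) ne
    by (intro degree_sum_less) (auto intro: le_less_trans[OF degree_smult_le] simp: card_gt_0_iff)
  show "degree u < card (\<tau> ` J)"
    using assms by (simp add: card_image)
  fix x assume "x \<in> \<tau> ` J"
  then obtain m where m: "m \<in> J" "x = \<tau> m" by auto
  have eq: "(\<Prod>l\<in>J - {k}. inverse (\<tau> k - \<tau> l) * (\<tau> m - \<tau> l)) = (if k = m then 1 else 0)" if "k \<in> J" for k
  proof (cases "k = m")
    case True
    have "\<tau> m \<noteq> \<tau> l" if "l \<in> J - {m}" for l
      using that inj_onD[OF assms(2), of m l] m(1) by auto
    then show ?thesis
      using True by (auto intro!: prod.neutral)
  next
    case False
    then have "m \<in> J - {k}" using m(1) by blast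
    then show ?thesis using assms(1) False by (auto intro!: prod_zero)
  qed
  have "poly ?v (\<tau> m) = (\<Sum>k\<in>J. poly u (\<tau> k) * (\<Prod>l\<in>J - {k}. inverse (\<tau> k - \<tau> l) * (\<tau> m - \<tau> l)))"
    by (simp add: poly_sum poly_prod algebra_simps)
  also have "\<dots> = (\<Sum>k\<in>J. if k = m then poly u (\<tau> k) else 0)"
    by (intro sum.cong refl) (simp add: eq)
  also have "\<dots> = poly u (\<tau> m)"
    using assms(1) m(1) by simp
  finally show "poly u x = poly ?v x"
    using m(2) by simp
qed

lemma polyfun_lagrange:
  assumes "p \<in> polyfun d" "finite J" "inj_on \<tau> J" "d i < card J"
  shows "p x = (\<Sum>k\<in>J. p (x(i := \<tau> k)) * (\<Prod>l\<in>J - {k}. inverse (\<tau> k - \<tau> l) * (x i - \<tau> l)))"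
proof -
  obtain u where u: "degree u \<le> d i" "\<And>t. p (x(i := t)) = poly u t"
    using polyfun_slice[OF assms(1)] by blast
  have "p x = poly u (x i)"
    using u(2)[of "x i"] by simp
  also have "\<dots> = poly (\<Sum>k\<in>J. smult (poly u (\<tau> k)) (\<Prod>l\<in>J - {k}. smult (inverse (\<tau> k - \<tau> l)) [:- \<tau> l, 1:])) (x i)"
    by (rule arg_cong[of _ _ "\<lambda>u. poly u (x i)"], rule lagrange_interpolation) (use assms u(1) in auto)
  also have "\<dots> = (\<Sum>k\<in>J. p (x(i := \<tau> k)) * (\<Prod>l\<in>J - {k}. inverse (\<tau> k - \<tau> l) * (x i - \<tau> l)))"
    by (simp add: poly_sum poly_prod u(2) algebra_simps)
  finally show ?thesis .
qed

lemma poly_eq_sum_coeff: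
  fixes u :: "'a::comm_semiring_1 poly"
  assumes "degree u \<le> n"
  shows "poly u x = (\<Sum>k\<le>n. coeff u k * x ^ k)"
proof -
  have "poly u x = poly (\<Sum>k\<le>n. monom (coeff u k) k) x"
    by (simp only: poly_as_sum_of_monoms'[OF assms])
  then show ?thesis
    by (simp add: poly_sum poly_monom)
qed

text \<open>Lagrange interpolation at \<open>d i + 1\<close> constants expresses \<open>p\<close>
  through the functions \<open>p (x(i := a))\<close>, which no longer involve \<open>x i\<close>.
  The bound on \<open>d i\<close> provides enough constants.\<close>

lemma polyfun_expand:
  fixes p :: "(nat \<Rightarrow> 'a::{field,finite}) \<Rightarrow> 'a"
  assumes "p \<in> polyfun d" "d i < CARD('a)"
  shows "\<exists>r. (\<forall>k. r k \<in> polyfun (d(i := 0))) \<and> p = (\<lambda>x. \<Sum>k\<le>d i. r k x * x i ^ k)"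
proof -
  obtain T :: "'a set" where T: "card T = Suc (d i)" "finite T"
    using obtain_subset_with_card_n[of "Suc (d i)" "UNIV :: 'a set"] assms(2) by auto
  define ell where "ell = (\<lambda>a. \<Prod>l\<in>T - {a}. smult (inverse (a - l)) [:- l, 1:])"
  have deg: "degree (ell a) \<le> d i" if "a \<in> T" for a
  proof -
    have "degree (ell a) \<le> (\<Sum>l\<in>T - {a}. degree (smult (inverse (a - l)) [:- l, 1:]))"
      unfolding ell_def
      using degree_prod_sum_le[of "T - {a}" "\<lambda>l. smult (inverse (a - l)) [:- l, 1:]"] T(2)
      by (simp add: o_def)
    also have "\<dots> \<le> (\<Sum>l\<in>T - {a}. 1)"
      by (intro sum_mono order_trans[OF degree_smult_le]) simp
    finally show ?thesis
      using T that by simp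
  qed
  define r where "r = (\<lambda>k x. \<Sum>a\<in>T. coeff (ell a) k * p (x(i := a)))"
  have "r k \<in> polyfun (d(i := 0))" for k
    unfolding r_def by (intro polyfun_sum polyfun_cmult polyfun_eval assms(1))
  moreover have "p x = (\<Sum>k\<le>d i. r k x * x i ^ k)" for x
  proof -
    have "p x = (\<Sum>a\<in>T. p (x(i := a)) * (\<Prod>l\<in>T - {a}. inverse (a - l) * (x i - l)))"
      using polyfun_lagrange[OF assms(1), of T "\<lambda>a. a" i x] T by simp
    also have "\<dots> = (\<Sum>a\<in>T. p (x(i := a)) * poly (ell a) (x i))"
      by (simp add: ell_def poly_prod algebra_simps)
    also have "\<dots> = (\<Sum>a\<in>T. p (x(i := a)) * (\<Sum>k\<le>d i. coeff (ell a) k * x i ^ k))"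
      by (intro sum.cong refl) (simp add: poly_eq_sum_coeff[OF deg])
    also have "\<dots> = (\<Sum>k\<le>d i. r k x * x i ^ k)"
      unfolding r_def sum_distrib_left sum_distrib_right
      by (subst sum.swap) (simp add: mult_ac)
    finally show ?thesis .
  qed
  ultimately show ?thesis by blast
qed

lemma polyfun_from_coeffs:
  assumes "\<And>k. k \<le> m \<Longrightarrow> r k \<in> polyfun (d(i := 0))"
  shows "(\<lambda>x. \<Sum>k\<le>m. r k x * x i ^ k) \<in> polyfun (d(i := m))"
proof (rule polyfun_sum)
  fix k assume "k \<in> {..m}"
  then show "(\<lambda>x. r k x * x i ^ k) \<in> polyfun (d(i := m))"
    using polyfun_mult_poly[OF assms[of k], of "monom 1 k" i "d(i := m)"]
    by (simp add: poly_monom degree_monom_eq)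
qed

text \<open>With the other coordinates frozen, both sides are polynomials in \<open>x i\<close> of
  degree below the field size that agree everywhere. Since \<open>d i = 0\<close>, the coefficients
  do not change with \<open>x i\<close>.\<close>

lemma polyfun_coeffs_unique:
  fixes r :: "nat \<Rightarrow> (nat \<Rightarrow> 'a::{field,finite}) \<Rightarrow> 'a"
  assumes "\<And>k. k \<le> m \<Longrightarrow> r k \<in> polyfun d" "\<And>k. k \<le> m \<Longrightarrow> s k \<in> polyfun d"
    and "d i = 0" "m < CARD('a)"
    and "\<And>x. (\<Sum>k\<le>m. r k x * x i ^ k) = (\<Sum>k\<le>m. s k x * x i ^ k)" "k \<le> m"
  shows "r k = s k"
proof
  fix x
  define u where "u = (\<lambda>r :: nat \<Rightarrow> (nat \<Rightarrow> 'a) \<Rightarrow> 'a. \<Sum>k\<le>m. monom (r k x) k)"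
  have deg: "degree (u r) < card (UNIV :: 'a set)" for r
    using degree_sum_le[of "{..m}" "\<lambda>k. monom (r k x) k" m] assms(4)
    unfolding u_def by (fastforce intro: order_trans[OF degree_monom_le])
  have "u r = u s"
  proof (rule poly_eqI_degree[of UNIV, OF _ deg deg])
    fix t
    have *: "r k (x(i := t)) = r k x" "s k (x(i := t)) = s k x" if "k \<le> m" for k
      using assms(3) by (auto intro!: polyfun_cong[OF assms(1)[OF that]] polyfun_cong[OF assms(2)[OF that]])
    show "poly (u r) t = poly (u s) t"
      using assms(5)[of "x(i := t)"] by (simp add: u_def poly_sum poly_monom *)
  qed
  then have "coeff (u r) k = coeff (u s) k" by simp
  moreover have "coeff (u r) k = r k x" for r
    using assms(6) by (simp add: u_def coeff_sum)
  ultimately show "r k x = s k x" by simp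
qed

lemma polyfun_0: "polyfun (\<lambda>_. 0) = range (\<lambda>a x. a)"
proof -
  have "p = (\<lambda>x. p (\<lambda>_. 0))" if "p \<in> polyfun (\<lambda>_. 0)" for p :: "(nat \<Rightarrow> 'a) \<Rightarrow> 'a"
    using polyfun_cong[OF that] by blast
  then show ?thesis by auto
qed

text \<open>Expansion in powers of one variable is a bijection with tuples of \<open>d i + 1\<close>
  functions of the remaining variables. Cardinalities take the place of dimensions from here
  on.\<close>

lemma card_polyfun:
  assumes "finite I" "\<And>i. i \<notin> I \<Longrightarrow> d i = 0" "\<And>i. d i < CARD('a)"
  shows "finite (polyfun d :: ((nat \<Rightarrow> 'a::{field,finite}) \<Rightarrow> 'a) set) \<and>
    card (polyfun d :: ((nat \<Rightarrow> 'a::{field,finite}) \<Rightarrow> 'a) set) = CARD('a) ^ (\<Prod>i\<in>I. Suc (d i))"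
  using assms
proof (induction I arbitrary: d rule: finite_induct)
  case empty
  then have "d = (\<lambda>_. 0)" by auto
  moreover have "inj (\<lambda>a. (\<lambda>x. a) :: (nat \<Rightarrow> 'a) \<Rightarrow> 'a)" by (auto simp: inj_on_def fun_eq_iff)
  ultimately show ?case
    by (simp add: polyfun_0) (simp add: card_image[of "\<lambda>a x. a"])
next
  case (insert i I)
  define e where "e = d(i := 0)"
  have "e k = 0" if "k \<notin> I" for k
    using insert.prems(1)[of k] that by (auto simp: e_def)
  moreover have "e k < CARD('a)" for k
    using insert.prems(2)[of k] by (simp add: e_def)
  ultimately have IH: "finite (polyfun e :: ((nat \<Rightarrow> 'a) \<Rightarrow> 'a) set)"
      "card (polyfun e :: ((nat \<Rightarrow> 'a) \<Rightarrow> 'a) set) = CARD('a) ^ (\<Prod>i\<in>I. Suc (e i))"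
    using insert.IH[of e] by blast+
  have pr: "(\<Prod>i\<in>I. Suc (e i)) = (\<Prod>i\<in>I. Suc (d i))"
    using insert.hyps by (intro prod.cong) (auto simp: e_def)
  define F :: "(nat \<Rightarrow> (nat \<Rightarrow> 'a) \<Rightarrow> 'a) \<Rightarrow> (nat \<Rightarrow> 'a) \<Rightarrow> 'a"
    where "F = (\<lambda>r x. \<Sum>k\<le>d i. r k x * x i ^ k)"
  have "bij_betw F ({..d i} \<rightarrow>\<^sub>E polyfun e) (polyfun d)"
  proof (rule bij_betw_imageI)
    show "inj_on F ({..d i} \<rightarrow>\<^sub>E polyfun e)"
    proof (rule inj_onI)
      fix r s assume r: "r \<in> {..d i} \<rightarrow>\<^sub>E polyfun e" and s: "s \<in> {..d i} \<rightarrow>\<^sub>E polyfun e"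
        and eq: "F r = F s"
      have "r k = s k" if "k \<le> d i" for k
        by (rule polyfun_coeffs_unique[of "d i" r e s i])
           (use r s fun_cong[OF eq] insert.prems(2) that in \<open>auto simp: F_def e_def PiE_def Pi_def\<close>)
      then show "r = s"
        using r s by (intro PiE_ext[of r _ _ s]) auto
    qed
    show "F ` ({..d i} \<rightarrow>\<^sub>E polyfun e) = polyfun d"
    proof (intro equalityI subsetI)
      fix p assume "p \<in> F ` ({..d i} \<rightarrow>\<^sub>E polyfun e)"
      then obtain r where r: "r \<in> {..d i} \<rightarrow>\<^sub>E polyfun e" "p = F r" by blast
      have "r k \<in> polyfun (d(i := 0))" if "k \<le> d i" for k
        using r(1) that by (auto simp: e_def PiE_def Pi_def)
      then show "p \<in> polyfun d"
        using polyfun_from_coeffs[of "d i" r d i] r(2) by (simp add: F_def)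
    next
      fix p :: "(nat \<Rightarrow> 'a) \<Rightarrow> 'a" assume "p \<in> polyfun d"
      then obtain r where "\<forall>k. r k \<in> polyfun e" "p = F r"
        using polyfun_expand[of p d i] insert.prems(2) unfolding F_def e_def by blast
      then have "p = F (restrict r {..d i})" "restrict r {..d i} \<in> {..d i} \<rightarrow>\<^sub>E polyfun e"
        by (auto simp: F_def)
      then show "p \<in> F ` ({..d i} \<rightarrow>\<^sub>E polyfun e)" by blast
    qed
  qed
  moreover have "finite ({..d i} \<rightarrow>\<^sub>E (polyfun e :: ((nat \<Rightarrow> 'a) \<Rightarrow> 'a) set))"
    using IH(1) by (intro finite_PiE) auto
  moreover have "card ({..d i} \<rightarrow>\<^sub>E (polyfun e :: ((nat \<Rightarrow> 'a) \<Rightarrow> 'a) set)) = CARD('a) ^ (\<Prod>i\<in>insert i I. Suc (d i))"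
    using IH(2) insert.hyps by (simp add: card_PiE pr mult.commute flip: power_mult power_Suc)
  ultimately show ?case
    using bij_betw_finite bij_betw_same_card by metis
qed

section \<open>Staircase degrees\<close>

text \<open>The bounds go by rank inside \<open>I\<close> rather than by the index itself, so that
  they adapt when a variable is removed from the middle.\<close>

definition stair :: "nat set \<Rightarrow> nat \<Rightarrow> nat" where
  "stair I i = (if i \<in> I then card {k \<in> I. k < i} else 0)"

definition stair1 :: "nat set \<Rightarrow> nat \<Rightarrow> nat" where
  "stair1 I i = (if i \<in> I then Suc (card {k \<in> I. k < i}) else 0)"

text \<open>For \<open>I = {..<n}\<close>, \<open>x i = y ^ (q ^ i)\<close> and
  \<open>c i j = c_j ^ (q ^ i)\<close> this is the norm of \<open>y + c_j\<close>.\<close>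

definition linprod :: "(nat \<Rightarrow> 'b \<Rightarrow> 'a::field) \<Rightarrow> nat set \<Rightarrow> 'b \<Rightarrow> (nat \<Rightarrow> 'a) \<Rightarrow> 'a" where
  "linprod c I j x = (\<Prod>i\<in>I. x i + c i j)"

lemma linprod_empty [simp]: "linprod c {} j x = 1"
  by (simp add: linprod_def)

lemma linprod_insert:
  "finite I \<Longrightarrow> i \<notin> I \<Longrightarrow> linprod c (insert i I) j x = (x i + c i j) * linprod c I j x"
  by (simp add: linprod_def)

lemma linprod_polyfun:
  assumes "finite I" "\<And>i. i \<in> I \<Longrightarrow> 0 < d i"
  shows "linprod c I j \<in> polyfun d"
proof -
  have "linprod c I j \<in> polyfun (\<lambda>i. if i \<in> I then 1 else 0)"
    using assms(1)
  proof (induction I rule: finite_induct)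
    case empty
    show ?case
      using polyfun_const[of 1] by (simp add: linprod_def[abs_def])
  next
    case (insert i I)
    have "(\<lambda>x. linprod c I j x * poly [:c i j, 1:] (x i)) \<in> polyfun (\<lambda>k. if k \<in> insert i I then 1 else 0)"
      by (rule polyfun_mult_poly[OF insert.IH]) (use insert.hyps in auto)
    then show ?case
      using insert.hyps by (simp add: linprod_def[abs_def] mult.commute add.commute)
  qed
  then show ?thesis
    by (rule polyfun_mono) (use assms(2) in \<open>auto simp: Suc_leI\<close>)
qed

context
  fixes A :: "nat set" and b :: nat
  assumes fin: "finite A" and max: "\<And>a. a \<in> A \<Longrightarrow> a < b"
begin

private lemma below:
  "{k. (k = b \<or> k \<in> A) \<and> k < b} = A"
  "a \<in> A \<Longrightarrow> {k. (k = b \<or> k \<in> A) \<and> k < a} = {k \<in> A. k < a}"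
  using max by (auto dest: less_asym)

text \<open>A new largest variable leaves all earlier ranks unchanged, which is why inductions on
  staircases add the maximum last.\<close>

lemma stair_insert: "stair (insert b A) = (stair A)(b := card A)"
  by (auto simp: stair_def fun_eq_iff below)

lemma stair1_insert: "stair1 (insert b A) = (stair1 A)(b := Suc (card A))"
  by (auto simp: stair1_def fun_eq_iff below)

end

lemma stair_notin: "i \<notin> I \<Longrightarrow> stair I i = 0" "i \<notin> I \<Longrightarrow> stair1 I i = 0"
  by (simp_all add: stair_def stair1_def)

lemma stair1_less: "finite I \<Longrightarrow> stair1 I i \<le> card I"
proof (cases "i \<in> I")
  case True
  assume "finite I"
  then have "card {k \<in> I. k < i} < card I"
    using True by (intro psubset_card_mono) auto
  then show ?thesis by (simp add: stair1_def)
qed (simp add: stair1_def)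

lemma stair_le_stair1: "stair I i \<le> stair1 I i"
  by (simp add: stair_def stair1_def)

lemma prod_stair:
  assumes "finite I"
  shows "(\<Prod>i\<in>I. Suc (stair I i)) = fact (card I) \<and> (\<Prod>i\<in>I. Suc (stair1 I i)) = fact (Suc (card I))"
  using assms
proof (induction I rule: finite_linorder_max_induct)
  case empty
  show ?case by simp
next
  case (insert b A)
  have "b \<notin> A" using insert.hyps(2) by blast
  moreover have "(\<Prod>i\<in>A. Suc (((stair A)(b := m)) i)) = (\<Prod>i\<in>A. Suc (stair A i))"
    "(\<Prod>i\<in>A. Suc (((stair1 A)(b := m)) i)) = (\<Prod>i\<in>A. Suc (stair1 A i))" for m
    using \<open>b \<notin> A\<close> by (auto intro!: prod.cong)
  ultimately show ?case
    using insert by (simp add: stair_insert stair1_insert)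
qed

lemma card_polyfun_stair:
  fixes I :: "nat set"
  assumes "finite I" "card I < CARD('a)"
  shows "finite (polyfun (stair I) :: ((nat \<Rightarrow> 'a::{field,finite}) \<Rightarrow> 'a) set)"
    "card (polyfun (stair I) :: ((nat \<Rightarrow> 'a) \<Rightarrow> 'a) set) = CARD('a) ^ fact (card I)"
    "finite (polyfun (stair1 I) :: ((nat \<Rightarrow> 'a) \<Rightarrow> 'a) set)"
    "card (polyfun (stair1 I) :: ((nat \<Rightarrow> 'a) \<Rightarrow> 'a) set) = CARD('a) ^ fact (Suc (card I))"
proof -
  have *: "stair1 I i < CARD('a)" "stair I i < CARD('a)" for i
    using stair1_less[OF assms(1), of i] stair_le_stair1[of I i] assms(2) by linarith+
  show "finite (polyfun (stair I) :: ((nat \<Rightarrow> 'a) \<Rightarrow> 'a) set)"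
    "card (polyfun (stair I) :: ((nat \<Rightarrow> 'a) \<Rightarrow> 'a) set) = CARD('a) ^ fact (card I)"
    using card_polyfun[where 'a = 'a, of I "stair I"] assms(1) * prod_stair[OF assms(1)]
    by (auto simp: stair_notin)
  show "finite (polyfun (stair1 I) :: ((nat \<Rightarrow> 'a) \<Rightarrow> 'a) set)"
    "card (polyfun (stair1 I) :: ((nat \<Rightarrow> 'a) \<Rightarrow> 'a) set) = CARD('a) ^ fact (Suc (card I))"
    using card_polyfun[where 'a = 'a, of I "stair1 I"] assms(1) * prod_stair[OF assms(1)]
    by (auto simp: stair_notin)
qed

text \<open>
  Interpolate in the largest variable \<open>x\<^sub>b\<close> at the \<open>card J\<close> points where one of the factors \<open>x\<^sub>b + c b k\<close>
  vanishes, and apply the induction hypothesis to the value at the \<open>k\<close>-th point with the index set \<open>J - {k}\<close>.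
\<close>

lemma stair1_decomposition:
  fixes c :: "nat \<Rightarrow> 'b \<Rightarrow> 'a::field"
  assumes "finite I" "finite J" "card J = Suc (card I)" "\<And>i. i \<in> I \<Longrightarrow> inj_on (c i) J"
    and "p \<in> polyfun (stair1 I)"
  shows "\<exists>r. (\<forall>j\<in>J. r j \<in> polyfun (stair I)) \<and> p = (\<lambda>x. \<Sum>j\<in>J. r j x * linprod c I j x)"
  using assms
proof (induction I arbitrary: J p rule: finite_linorder_max_induct)
  case empty
  then obtain j where J: "J = {j}"
    by (auto simp: card_Suc_eq)
  have "stair1 {} = (\<lambda>_. 0)" "stair {} = (\<lambda>_. 0)"
    by (auto simp: stair1_def stair_def)
  then show ?case
    using empty.prems(4) J by (intro exI[of _ "\<lambda>_. p"]) simp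
next
  case (insert b A)
  have bA: "b \<notin> A" using insert.hyps(2) by blast
  have cJ: "card J = Suc (Suc (card A))"
    using insert.prems(2) insert.hyps(1) bA by simp
  have injb: "inj_on (c b) J" using insert.prems(3) by simp
  define \<tau> where "\<tau> = (\<lambda>j. - c b j)"
  have inj: "inj_on \<tau> J"
    using injb by (auto simp: \<tau>_def inj_on_def)
  define w where "w = (\<lambda>k. \<Prod>l\<in>J - {k}. inverse (\<tau> k - \<tau> l))"
  have "stair1 (insert b A) = (stair1 A)(b := Suc (card A))"
    by (rule stair1_insert) (use insert.hyps in auto)
  then have p: "p \<in> polyfun ((stair1 A)(b := Suc (card A)))"
    using insert.prems(4) by metis
  have "\<exists>r. (\<forall>j\<in>J - {k}. r j \<in> polyfun (stair A)) \<and>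
      (\<lambda>x. p (x(b := \<tau> k))) = (\<lambda>x. \<Sum>j\<in>J - {k}. r j x * linprod c A j x)" if "k \<in> J" for k
  proof (rule insert.IH)
    have "(\<lambda>x. p (x(b := \<tau> k))) \<in> polyfun ((stair1 A)(b := Suc (card A), b := 0))"
      by (rule polyfun_eval[OF p])
    moreover have "(stair1 A)(b := Suc (card A), b := 0) = stair1 A"
      using bA by (auto simp: stair_notin)
    ultimately show "(\<lambda>x. p (x(b := \<tau> k))) \<in> polyfun (stair1 A)" by simp
    show "inj_on (c i) (J - {k})" if "i \<in> A" for i
      using insert.prems(3)[of i] that by (auto intro: inj_on_subset)
  qed (use insert.prems(1) cJ that in auto)
  then obtain r where r: "\<And>k j. k \<in> J \<Longrightarrow> j \<in> J - {k} \<Longrightarrow> r k j \<in> polyfun (stair A)"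
    "\<And>k. k \<in> J \<Longrightarrow> (\<lambda>x. p (x(b := \<tau> k))) = (\<lambda>x. \<Sum>j\<in>J - {k}. r k j x * linprod c A j x)"
    by metis
  \<comment> \<open>The factor \<open>x b + c b j\<close> of the k-th basis polynomial is absorbed
    into \<open>linprod c (insert b A) j\<close>. The \<open>card A\<close> factors left over give
    exactly the degree in \<open>x b\<close> that \<open>stair\<close> allows.\<close>
  define s where "s = (\<lambda>j x. \<Sum>k\<in>J - {j}. r k j x * poly (smult (w k) (\<Prod>l\<in>J - {k} - {j}. [:c b l, 1:])) (x b))"
  have "s j \<in> polyfun (stair (insert b A))" if "j \<in> J" for j
    unfolding s_def
  proof (intro polyfun_sum polyfun_mult_poly)
    fix k assume k: "k \<in> J - {j}"
    show "r k j \<in> polyfun (stair A)"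
      using r(1)[of k j] k that by blast
    have "degree (smult (w k) (\<Prod>l\<in>J - {k} - {j}. [:c b l, 1:])) \<le> (\<Sum>l\<in>J - {k} - {j}. degree [:c b l, 1:])"
      using degree_prod_sum_le[of "J - {k} - {j}" "\<lambda>l. [:c b l, 1:]"] insert.prems(1)
      by (intro order_trans[OF degree_smult_le]) (simp add: o_def)
    also have "\<dots> = card A"
      using cJ insert.prems(1) k that by (auto simp: card_Diff_singleton_if)
    finally show "degree (smult (w k) (\<Prod>l\<in>J - {k} - {j}. [:c b l, 1:])) + stair A b \<le> stair (insert b A) b"
      using bA insert.hyps by (simp add: stair_insert stair_notin)
    show "stair A m \<le> stair (insert b A) m" if "m \<noteq> b" for m
      using that insert.hyps by (simp add: stair_insert)
  qed
  moreover have "p x = (\<Sum>j\<in>J. s j x * linprod c (insert b A) j x)" for x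
  proof -
    have "p x = (\<Sum>k\<in>J. p (x(b := \<tau> k)) * (\<Prod>l\<in>J - {k}. inverse (\<tau> k - \<tau> l) * (x b - \<tau> l)))"
      by (rule polyfun_lagrange[OF p]) (use insert.prems(1) inj cJ in auto)
    also have "\<dots> = (\<Sum>k\<in>J. \<Sum>j\<in>J - {k}. (r k j x * linprod c A j x) * (w k * (\<Prod>l\<in>J - {k}. x b + c b l)))"
    proof (intro sum.cong refl)
      fix k assume "k \<in> J"
      then have "p (x(b := \<tau> k)) = (\<Sum>j\<in>J - {k}. r k j x * linprod c A j x)"
        using fun_cong[OF r(2), of k x] by simp
      then show "p (x(b := \<tau> k)) * (\<Prod>l\<in>J - {k}. inverse (\<tau> k - \<tau> l) * (x b - \<tau> l)) =
          (\<Sum>j\<in>J - {k}. (r k j x * linprod c A j x) * (w k * (\<Prod>l\<in>J - {k}. x b + c b l)))"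
        by (simp only: w_def prod.distrib sum_distrib_right) (simp add: \<tau>_def)
    qed
    also have "\<dots> = (\<Sum>k\<in>J. \<Sum>j\<in>J - {k}. r k j x * (w k * (\<Prod>l\<in>J - {k} - {j}. x b + c b l)) *
        linprod c (insert b A) j x)"
    proof (intro sum.cong refl)
      fix k j assume "k \<in> J" "j \<in> J - {k}"
      then have "(\<Prod>l\<in>J - {k}. x b + c b l) = (x b + c b j) * (\<Prod>l\<in>J - {k} - {j}. x b + c b l)"
        using insert.prems(1) by (simp add: prod.remove)
      then show "(r k j x * linprod c A j x) * (w k * (\<Prod>l\<in>J - {k}. x b + c b l)) =
          r k j x * (w k * (\<Prod>l\<in>J - {k} - {j}. x b + c b l)) * linprod c (insert b A) j x"
        using insert.hyps(1) bA by (simp add: linprod_insert mult_ac)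
    qed
    also have "\<dots> = (\<Sum>j\<in>J. \<Sum>k\<in>J - {j}. r k j x * (w k * (\<Prod>l\<in>J - {k} - {j}. x b + c b l)) *
        linprod c (insert b A) j x)"
    proof -
      have "(\<Sum>k\<in>J. \<Sum>j\<in>J - {k}. f k j) = (\<Sum>j\<in>J. \<Sum>k\<in>J - {j}. f k j)" for f :: "'b \<Rightarrow> 'b \<Rightarrow> 'a"
        using sum.swap_restrict[OF insert.prems(1) insert.prems(1), of f "\<lambda>k j. j \<noteq> k"]
        by (simp add: set_diff_eq eq_commute[of _ "_ :: 'b"] cong: conj_cong)
      then show ?thesis .
    qed
    also have "\<dots> = (\<Sum>j\<in>J. s j x * linprod c (insert b A) j x)"
      by (simp add: s_def sum_distrib_right poly_prod add.commute)
    finally show ?thesis .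
  qed
  ultimately show ?case by blast
qed

text \<open>
  The decomposition map is surjective between finite sets of the same size, since
  \<open>(card I + 1) * fact (card I) = fact (card I + 1)\<close>; hence it is injective.
\<close>

lemma stair_syzygy:
  fixes c :: "nat \<Rightarrow> 'b \<Rightarrow> 'a::{field,finite}"
  assumes "finite I" "finite J" "card J = Suc (card I)" "\<And>i. i \<in> I \<Longrightarrow> inj_on (c i) J"
    and "card I < CARD('a)" "\<And>j. j \<in> J \<Longrightarrow> r j \<in> polyfun (stair I)"
    and "\<And>x. (\<Sum>j\<in>J. r j x * linprod c I j x) = 0" "j \<in> J"
  shows "r j = (\<lambda>x. 0)"
proof -
  define B B1 where "B = (polyfun (stair I) :: ((nat \<Rightarrow> 'a) \<Rightarrow> 'a) set)"
    and "B1 = (polyfun (stair1 I) :: ((nat \<Rightarrow> 'a) \<Rightarrow> 'a) set)"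
  define F where "F = (\<lambda>r x. \<Sum>j\<in>J. r j x * linprod c I j x)"
  note card = card_polyfun_stair[where 'a = 'a, OF assms(1,5), folded B_def B1_def]
  have "B1 \<subseteq> F ` (J \<rightarrow>\<^sub>E B)"
  proof
    fix p assume "p \<in> B1"
    then obtain r where "\<forall>j\<in>J. r j \<in> B" "p = F r"
      using stair1_decomposition[of I J c p] assms(1-4) unfolding B_def B1_def F_def by blast
    then have "restrict r J \<in> J \<rightarrow>\<^sub>E B" "p = F (restrict r J)"
      by (auto simp: F_def)
    then show "p \<in> F ` (J \<rightarrow>\<^sub>E B)" by blast
  qed
  moreover have fin: "finite (J \<rightarrow>\<^sub>E B)"
    using assms(2) card(1) by (intro finite_PiE) auto
  moreover have "card (J \<rightarrow>\<^sub>E B) = card B1"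
    using assms(2,3) card by (simp add: card_PiE power_add mult.commute flip: power_mult)
  ultimately have "card (F ` (J \<rightarrow>\<^sub>E B)) = card (J \<rightarrow>\<^sub>E B)"
    by (metis card_image_le card_mono finite_imageI le_antisym)
  then have inj: "inj_on F (J \<rightarrow>\<^sub>E B)"
    using fin by (rule eq_card_imp_inj_on[rotated])
  have "F (restrict r J) = F (restrict (\<lambda>j x. 0) J)"
    using assms(7) by (simp add: F_def cong: sum.cong)
  moreover have "restrict r J \<in> J \<rightarrow>\<^sub>E B" "restrict (\<lambda>j x. 0) J \<in> J \<rightarrow>\<^sub>E B"
    using assms(6) by (auto simp: B_def)
  ultimately have "restrict r J = restrict (\<lambda>j x. 0) J"
    using inj by (rule inj_onD[rotated 1])
  then show ?thesis
    using assms(8) by (metis restrict_apply')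
qed

lemma linprod_upd:
  assumes "finite I" "i \<in> I"
  shows "linprod c I j (x(i := t)) = (t + c i j) * linprod c (I - {i}) j x"
proof -
  have "linprod c (I - {i}) j (x(i := t)) = linprod c (I - {i}) j x"
    unfolding linprod_def by (intro prod.cong) auto
  then show ?thesis
    using assms linprod_insert[of "I - {i}" i c j "x(i := t)"] by (simp add: insert_absorb)
qed

text \<open>
  The coefficient of the highest power of \<open>x\<^sub>i\<close> in the sum is a syzygy of the products over \<open>I - {i}\<close>.
\<close>

lemma stair_coeffs_degree:
  fixes c :: "nat \<Rightarrow> 'b \<Rightarrow> 'a::{field,finite}"
  assumes I: "finite I" "i \<in> I" and J: "finite J" "card J = card I"
    and inj: "\<And>k. k \<in> I - {i} \<Longrightarrow> inj_on (c k) J"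
    and card: "card I < CARD('a)" "Suc (d i) < CARD('a)"
    and d: "\<And>k. k \<noteq> i \<Longrightarrow> d k \<le> stair (I - {i}) k"
    and r: "\<And>j. j \<in> J \<Longrightarrow> r j \<in> polyfun d"
    and h: "(\<lambda>x. \<Sum>j\<in>J. r j x * (linprod c I j x - \<gamma> j)) \<in> polyfun e" "e i \<le> d i"
    and j: "j \<in> J"
  shows "(e i = 0 \<longrightarrow> r j = (\<lambda>x. 0)) \<and> r j \<in> polyfun (d(i := e i - 1))"
proof -
  have "\<exists>s. \<forall>j\<in>J. (\<forall>k. s j k \<in> polyfun (d(i := 0))) \<and> r j = (\<lambda>x. \<Sum>k\<le>d i. s j k x * x i ^ k)"
    using r card(2) by (intro bchoice ballI polyfun_expand) auto
  then obtain s where s: "\<And>j k. j \<in> J \<Longrightarrow> s j k \<in> polyfun (d(i := 0))"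
    "\<And>j. j \<in> J \<Longrightarrow> r j = (\<lambda>x. \<Sum>k\<le>d i. s j k x * x i ^ k)"
    by blast
  have top: "\<forall>j\<in>J. s j k = (\<lambda>x. 0)" if "e i \<le> k" "k \<le> d i" for k
    using that
  proof (induction "d i - k" arbitrary: k rule: less_induct)
    case less
    have IH: "s j (Suc k) x = 0" if "Suc k \<le> d i" "j \<in> J" for j x
      using less.hyps[of "Suc k"] less.prems that by auto
    \<comment> \<open>Compare coefficients of the power \<open>k + 1\<close> of \<open>x i\<close>.
      The right-hand side has degree at most \<open>e i \<le> k\<close>, and since
      \<open>s j (Suc k)\<close> vanishes, each summand contributes only
      \<open>s j k x * P j\<close>.\<close>
    have zero: "(\<Sum>j\<in>J. s j k x * linprod c (I - {i}) j x) = 0" for x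
    proof -
      define S where "S = (\<lambda>j. \<Sum>k\<le>d i. monom (s j k x) k)"
      define P where "P = (\<lambda>j. linprod c (I - {i}) j x)"
      define U where "U = (\<Sum>j\<in>J. S j * [:P j * c i j - \<gamma> j, P j:])"
      obtain v where v: "degree v \<le> e i"
        "\<And>t. (\<Sum>j\<in>J. r j (x(i := t)) * (linprod c I j (x(i := t)) - \<gamma> j)) = poly v t"
        using polyfun_slice[OF h(1)] by blast
      have dS: "degree (S j) \<le> d i" for j
        unfolding S_def by (rule degree_sum_le) (auto intro: order_trans[OF degree_monom_le])
      have "degree (S j * [:P j * c i j - \<gamma> j, P j:]) \<le> Suc (d i)" for j
        using dS[of j] by (intro order_trans[OF degree_mult_le]) auto
      then have dU: "degree U \<le> Suc (d i)"
        unfolding U_def using J(1) by (intro degree_sum_le) auto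
      have "U = v"
      proof (rule poly_eqI_degree[of UNIV])
        fix t
        have "poly (S j) t = r j (x(i := t))" if "j \<in> J" for j
        proof -
          have "s j k (x(i := t)) = s j k x" for k
            by (rule polyfun_cong[OF s(1)[OF that]]) auto
          then show ?thesis
            using that by (simp add: s(2) S_def poly_sum poly_monom)
        qed
        then have "poly U t = (\<Sum>j\<in>J. r j (x(i := t)) * (linprod c I j (x(i := t)) - \<gamma> j))"
          unfolding U_def poly_sum poly_mult
          by (intro sum.cong refl) (simp add: linprod_upd[OF I] P_def algebra_simps)
        then show "poly U t = poly v t" using v(2) by simp
      qed (use dU v(1) h(2) card(2) in auto)
      then have "coeff U (Suc k) = 0"
        using v(1) less.prems(1) by (simp add: coeff_eq_0)
      moreover have "coeff (S j * [:P j * c i j - \<gamma> j, P j:]) (Suc k) = s j k x * P j" if "j \<in> J" for j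
      proof -
        have "coeff (S j) (Suc k) = 0"
          using IH[OF _ that] by (auto simp: S_def coeff_sum)
        moreover have "coeff (S j) k = s j k x"
          using less.prems(2) by (simp add: S_def coeff_sum)
        ultimately show ?thesis
          by (simp add: mult_pCons_right)
      qed
      ultimately show ?thesis
        by (simp add: U_def coeff_sum P_def)
    qed
    show ?case
    proof
      fix j assume "j \<in> J"
      have "card (I - {i}) < CARD('a)" "card J = Suc (card (I - {i}))"
        using I card(1) J(2) card_Suc_Diff1[OF I] by auto
      moreover have "s j k \<in> polyfun (stair (I - {i}))" if "j \<in> J" for j
        by (rule polyfun_mono[OF s(1)[OF that]]) (use d in auto)
      ultimately show "s j k = (\<lambda>x. 0)"
        using stair_syzygy[of "I - {i}" J c "\<lambda>j. s j k" j] I(1) J(1) inj zero \<open>j \<in> J\<close> by blast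
    qed
  qed
  have "r j x = (\<Sum>k\<in>{..d i} \<inter> {..<e i}. s j k x * x i ^ k)" for x
    unfolding s(2)[OF j] using top j by (intro sum.mono_neutral_right) (auto simp: not_less)
  moreover have "{..d i} \<inter> {..<e i} = {..<e i}"
    using h(2) by auto
  ultimately have rj: "r j = (\<lambda>x. \<Sum>k<e i. s j k x * x i ^ k)"
    by auto
  \<comment> \<open>Only powers below \<open>e i\<close> survive. The case \<open>e i = 0\<close> is
    separate because \<open>e i - 1\<close> is a truncated subtraction.\<close>
  show ?thesis
  proof (cases "e i = 0")
    case True
    then show ?thesis using rj by simp
  next
    case False
    then have "{..<e i} = {..e i - 1}" by auto
    then show ?thesis
      using False rj polyfun_from_coeffs[of "e i - 1" "s j" d i] s(1)[OF j] by simp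
  qed
qed

lemma stair_lessThan: "stair {..<n} i = (if i < n then i else 0)"
proof -
  have "{k \<in> {..<n}. k < i} = {..<i}" if "i < n" using that by auto
  then show ?thesis by (simp add: stair_def)
qed

lemma stair1_lessThan: "stair1 {..<n} i = (if i < n then Suc i else 0)"
proof -
  have "{k \<in> {..<n}. k < i} = {..<i}" if "i < n" using that by auto
  then show ?thesis by (simp add: stair1_def)
qed

lemma stair_lessThan_minus:
  assumes "i < n"
  shows "stair ({..<n} - {i}) k = (if k < i then k else if i < k \<and> k < n then k - 1 else 0)"
proof -
  have "{l \<in> {..<n} - {i}. l < k} = {..<k}" if "k < i" using that assms by auto
  moreover have "{l \<in> {..<n} - {i}. l < k} = {..<k} - {i}" if "i < k" "k < n" using that assms by auto
  ultimately show ?thesis using assms by (auto simp: stair_def)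
qed

section \<open>Systems of norm equations\<close>

text \<open>The conjugates of \<open>y\<close> become independent variables, and
  \<open>c i j\<close> generalizes the i-th conjugate of the j-th shift. All degrees stay at most
  \<open>n\<close>, so \<open>n < CARD('a)\<close> lets functions stand for polynomials.\<close>

locale norm_system =
  fixes n :: nat and c :: "nat \<Rightarrow> nat \<Rightarrow> 'a::{field,finite}" and \<gamma> :: "nat \<Rightarrow> 'a"
  assumes n: "3 \<le> n" "n < CARD('a)"
    and inj: "\<And>i. i < n \<Longrightarrow> inj_on (c i) {..n}"
begin

definition eqn :: "nat \<Rightarrow> (nat \<Rightarrow> 'a) \<Rightarrow> 'a" where
  "eqn j x = linprod c {..<n} j x - \<gamma> j"

lemma inj': "i < n \<Longrightarrow> inj_on (c i) {..<n}"
  using inj by (rule inj_on_subset) auto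

lemma eqn_polyfun: "eqn j \<in> polyfun (\<lambda>i. if i < n then 1 else 0)"
  unfolding eqn_def[abs_def]
  by (rule polyfun_diff) (auto intro: linprod_polyfun)

text \<open>This makes the sum of the multiples of the first \<open>n\<close> equations direct. The
  total is zero, so the degree lemma with bound 0 kills every coefficient; deleting the variable
  \<open>n - 1\<close> leaves the staircase on the others unchanged.\<close>

lemma eqn_syzygy:
  assumes "\<And>j. j < n \<Longrightarrow> r j \<in> polyfun (stair {..<n})" "\<And>x. (\<Sum>j<n. r j x * eqn j x) = 0" "j < n"
  shows "r j = (\<lambda>x. 0)"
proof -
  have "(\<lambda>x. \<Sum>j<n. r j x * (linprod c {..<n} j x - \<gamma> j)) = (\<lambda>x. 0)"
    using assms(2) by (simp add: eqn_def fun_eq_iff)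
  then have h: "(\<lambda>x. \<Sum>j<n. r j x * (linprod c {..<n} j x - \<gamma> j)) \<in> polyfun (\<lambda>_. 0)"
    by simp
  show ?thesis
    by (rule stair_coeffs_degree[OF _ _ _ _ _ _ _ _ _ h, of "n - 1" "stair {..<n}", THEN conjunct1, THEN mp])
       (use n inj' assms(1,3) in \<open>auto simp: stair_lessThan stair_lessThan_minus\<close>)
qed

text \<open>The bounds are lowered one variable at a time, from \<open>n - 1\<close> down to 0;
  \<open>D m\<close> has those with index at least \<open>m\<close> lowered. Going downwards
  matters: the degree lemma for \<open>x i\<close> needs reduced bounds at all larger
  indices.\<close>

lemma eqn_coeffs_degree:
  assumes r: "\<And>j. j < n \<Longrightarrow> r j \<in> polyfun (stair {..<n})"
    and h: "(\<lambda>x. \<Sum>j<n. r j x * eqn j x) \<in> polyfun e"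
    and e: "\<And>i. i < n \<Longrightarrow> 1 \<le> e i \<and> e i \<le> 2" and j: "j < n"
  shows "r j \<in> polyfun (\<lambda>i. if i < n then min i (e i - 1) else 0)"
proof -
  define D where "D = (\<lambda>m i. if i < n then if m \<le> i then min i (e i - 1) else i else 0)"
  have "\<forall>j<n. r j \<in> polyfun (D m)" if "m \<le> n" for m
    using that
  proof (induction m rule: inc_induct)
    case base
    have "stair {..<n} = D n"
      by (auto simp: D_def stair_lessThan)
    then show ?case using r by simp
  next
    case (step i)
    show ?case
    proof (cases "i \<le> e i - 1")
      case True
      then have "D i = D (Suc i)"
        by (auto simp: D_def fun_eq_iff le_Suc_eq not_le less_Suc_eq Suc_le_eq)
      then show ?thesis using step.IH by simp
    next
      case False
      show ?thesis
      proof (intro allI impI)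
        fix j assume "j < n"
        have "r j \<in> polyfun ((D (Suc i))(i := e i - 1))"
        proof (rule stair_coeffs_degree[THEN conjunct2])
          \<comment> \<open>Here \<open>i > e i - 1\<close>, so \<open>i \<ge> 1\<close>; for
            \<open>k > i\<close> this gives \<open>e k - 1 \<le> 1 \<le> k - 1\<close>.\<close>
          show "D (Suc i) k \<le> stair ({..<n} - {i}) k" if "k \<noteq> i" for k
            using that step.hyps e[of k] False e[of i] by (auto simp: D_def stair_lessThan_minus)
          show "(\<lambda>x. \<Sum>j<n. r j x * (linprod c {..<n} j x - \<gamma> j)) \<in> polyfun e"
            using h by (simp add: eqn_def)
        qed (use step n inj' \<open>j < n\<close> False in \<open>auto simp: D_def\<close>)
        also have "(D (Suc i))(i := e i - 1) = D i"
          using False step.hyps by (auto simp: D_def fun_eq_iff)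
        finally show "r j \<in> polyfun (D i)" .
      qed
    qed
  qed
  from this[of 0] have "r j \<in> polyfun (D 0)"
    using j by simp
  also have "D 0 = (\<lambda>i. if i < n then min i (e i - 1) else 0)"
    by (auto simp: D_def)
  finally show ?thesis .
qed

text \<open>
  The two relations for \<open>i = n - 1\<close> and \<open>i = n - 2\<close> have coefficients depending on \<open>x\<^sub>i\<close> only, and
  multiplying crosswise shows that the multiplier \<open>\<mu> + \<nu> * x i\<close> divides them.
\<close>

lemma eqn_division:
  assumes g: "g \<in> polyfun (\<lambda>i. if i < n then 1 else 0)"
    and mult: "\<And>i. 1 \<le> i \<Longrightarrow> i < n \<Longrightarrow> \<exists>\<mu> \<nu> r. (\<mu>, \<nu>) \<noteq> (0, 0) \<and> (\<forall>j<n. r j \<in> polyfun (stair {..<n})) \<and>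
      (\<forall>x. (\<mu> + \<nu> * x i) * g x = (\<Sum>j<n. r j x * eqn j x))"
  shows "\<exists>q. \<forall>x. g x = (\<Sum>j<n. q j * eqn j x)"
proof -
  \<comment> \<open>Both indices are positive as \<open>n \<ge> 3\<close>, so a product of linear
    functions of \<open>x a\<close> and \<open>x b\<close> still respects the staircase.\<close>
  define a b where "a = n - 1" and "b = n - 2"
  have ab: "a < n" "b < n" "1 \<le> a" "1 \<le> b" "a \<noteq> b"
    using n by (auto simp: a_def b_def)
  have deg: "r j \<in> polyfun ((\<lambda>_. 0)(i := 1))"
    if "1 \<le> i" "i < n" "\<forall>j<n. r j \<in> polyfun (stair {..<n})"
      "\<forall>x. (\<mu> + \<nu> * x i) * g x = (\<Sum>j<n. r j x * eqn j x)" "j < n" for i \<mu> \<nu> r j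
  proof -
    \<comment> \<open>The left-hand side has degree at most 2 in \<open>x i\<close> and 1 in the
      others, so the coefficients are linear in \<open>x i\<close> and constant in the rest.\<close>
    define e where "e = (\<lambda>k. if k < n then if k = i then 2 else 1 else 0 :: nat)"
    have "(\<lambda>x. g x * poly [:\<mu>, \<nu>:] (x i)) \<in> polyfun e"
      by (rule polyfun_mult_poly[OF g]) (use \<open>i < n\<close> in \<open>auto simp: e_def\<close>)
    then have "(\<lambda>x. \<Sum>j<n. r j x * eqn j x) \<in> polyfun e"
      using that(4) by (simp add: mult.commute)
    then have "r j \<in> polyfun (\<lambda>k. if k < n then min k (e k - 1) else 0)"
      by (rule eqn_coeffs_degree[rotated]) (use that in \<open>auto simp: e_def\<close>)
    then show ?thesis
      by (rule polyfun_mono) (auto simp: e_def)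
  qed
  obtain \<mu> \<nu> r where r: "(\<mu>, \<nu>) \<noteq> (0, 0)" "\<forall>j<n. r j \<in> polyfun (stair {..<n})"
    "\<forall>x. (\<mu> + \<nu> * x a) * g x = (\<Sum>j<n. r j x * eqn j x)"
    using mult[OF ab(3,1)] by blast
  obtain \<mu>' \<nu>' r' where r': "(\<mu>', \<nu>') \<noteq> (0, 0)" "\<forall>j<n. r' j \<in> polyfun (stair {..<n})"
    "\<forall>x. (\<mu>' + \<nu>' * x b) * g x = (\<Sum>j<n. r' j x * eqn j x)"
    using mult[OF ab(4,2)] by blast
  note ra = deg[OF ab(3,1) r(2,3)] and rb = deg[OF ab(4,2) r'(2,3)]
  have eq: "(\<mu>' + \<nu>' * x b) * r j x = (\<mu> + \<nu> * x a) * r' j x" if "j < n" for j x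
  proof -
    define s where "s = (\<lambda>j x. r j x * poly [:\<mu>', \<nu>':] (x b) - r' j x * poly [:\<mu>, \<nu>:] (x a))"
    have "s j \<in> polyfun (stair {..<n})" if "j < n" for j
      unfolding s_def
    proof (rule polyfun_diff)
      show "(\<lambda>x. r j x * poly [:\<mu>', \<nu>':] (x b)) \<in> polyfun (stair {..<n})"
        by (rule polyfun_mult_poly[OF ra[OF that]]) (use ab in \<open>auto simp: stair_lessThan\<close>)
      show "(\<lambda>x. r' j x * poly [:\<mu>, \<nu>:] (x a)) \<in> polyfun (stair {..<n})"
        by (rule polyfun_mult_poly[OF rb[OF that]]) (use ab in \<open>auto simp: stair_lessThan\<close>)
    qed
    moreover have "(\<Sum>j<n. s j x * eqn j x) = 0" for x
    proof -
      have "(\<Sum>j<n. s j x * eqn j x) = (\<mu>' + \<nu>' * x b) * (\<Sum>j<n. r j x * eqn j x) -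
          (\<mu> + \<nu> * x a) * (\<Sum>j<n. r' j x * eqn j x)"
        unfolding sum_distrib_left sum_subtractf[symmetric]
        by (intro sum.cong refl) (simp add: s_def algebra_simps)
      also have "\<dots> = 0"
        using r(3) r'(3) by (metis (no_types) mult.left_commute right_minus_eq)
      finally show ?thesis .
    qed
    ultimately have "s j x = 0"
      using eqn_syzygy[of s j] that by simp
    then show ?thesis by (simp add: s_def algebra_simps)
  qed
  \<comment> \<open>The second multiplier is nonzero at \<open>t\<close>. Freezing
    \<open>x b = t\<close> in the crosswise identity leaves \<open>r j\<close> as the first
    multiplier times a constant.\<close>
  define t where "t = (if \<mu>' = 0 then 1 else (0 :: 'a))"
  have t: "\<mu>' + \<nu>' * t \<noteq> 0"
    using r'(1) by (auto simp: t_def)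
  define q where "q = (\<lambda>j. r' j (\<lambda>_. t) / (\<mu>' + \<nu>' * t))"
  have rq: "r j x = (\<mu> + \<nu> * x a) * q j" if "j < n" for j x
  proof -
    have "r j x = r j (x(b := t))"
      by (rule polyfun_cong[OF ra[OF that]]) (use ab in auto)
    moreover have "r' j (x(b := t)) = r' j (\<lambda>_. t)"
      by (rule polyfun_cong[OF rb[OF that]]) (auto split: if_splits)
    ultimately show ?thesis
      using eq[OF that, of "x(b := t)"] ab(5) t by (simp add: q_def field_simps)
  qed
  define G where "G = (\<lambda>x. g x - (\<Sum>j<n. q j * eqn j x))"
  have G: "G \<in> polyfun (\<lambda>i. if i < n then 1 else 0)"
    unfolding G_def by (intro polyfun_diff g polyfun_sum polyfun_cmult eqn_polyfun)
  have G0: "(\<mu> + \<nu> * x a) * G x = 0" for x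
  proof -
    have "(\<mu> + \<nu> * x a) * (\<Sum>j<n. q j * eqn j x) = (\<Sum>j<n. r j x * eqn j x)"
      unfolding sum_distrib_left by (intro sum.cong refl) (simp add: rq mult_ac)
    then show ?thesis
      using r(3) by (simp add: G_def right_diff_distrib)
  qed
  \<comment> \<open>\<open>G\<close> is linear in \<open>x a\<close> and vanishes wherever the
    multiplier does not, which excludes at most one value of \<open>x a\<close>.\<close>
  have "G x = 0" for x
  proof -
    obtain u where u: "degree u \<le> 1" "\<And>s. G (x(a := s)) = poly u s"
      using polyfun_slice[OF G, of a x] ab(1) by auto
    have "u = 0"
    proof (rule poly_eqI_degree[of "{s. poly [:\<mu>, \<nu>:] s \<noteq> 0}"])
      show "poly u s = poly 0 s" if "s \<in> {s. poly [:\<mu>, \<nu>:] s \<noteq> 0}" for s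
        using G0[of "x(a := s)"] that u(2)[of s] by (simp add: mult.commute)
      have "card {s. poly [:\<mu>, \<nu>:] s = 0} \<le> degree [:\<mu>, \<nu>:]"
        by (rule card_poly_roots_bound) (use r(1) in auto)
      also have "\<dots> \<le> 1" by simp
      finally have "card {s. poly [:\<mu>, \<nu>:] s = 0} \<le> 1" .
      moreover have "{s. poly [:\<mu>, \<nu>:] s \<noteq> 0} = UNIV - {s. poly [:\<mu>, \<nu>:] s = 0}" by auto
      ultimately have "2 < card {s. poly [:\<mu>, \<nu>:] s \<noteq> 0} + 1"
        using n by (simp add: card_Diff_subset)
      then show "degree u < card {s. poly [:\<mu>, \<nu>:] s \<noteq> 0}" "degree (0 :: 'a poly) < card {s. poly [:\<mu>, \<nu>:] s \<noteq> 0}"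
        using u(1) by simp_all
    qed
    then show ?thesis
      using u(2)[of "x a"] by simp
  qed
  then show ?thesis
    unfolding G_def by (metis right_minus_eq)
qed

end

section \<open>Interpolation on the solution set and linear dependence of the equations\<close>

lemma interpolating_poly:
  fixes \<phi> :: "'a::field \<Rightarrow> 'a"
  assumes "finite Y"
  shows "\<exists>u. \<forall>y\<in>Y. poly u y = \<phi> y"
  using assms
proof (induction Y rule: finite_induct)
  case (insert y Y)
  then obtain u where u: "\<forall>y\<in>Y. poly u y = \<phi> y" by blast
  define v where "v = (\<Prod>z\<in>Y. [:- z, 1:])"
  have v: "poly v z = 0" if "z \<in> Y" for z
    using insert.hyps(1) that by (auto simp: v_def poly_prod)
  have "poly v y \<noteq> 0"
    using insert.hyps by (auto simp: v_def poly_prod)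
  then have "poly (u + smult ((\<phi> y - poly u y) / poly v y) v) y = \<phi> y"
    by simp
  then show ?case
    using u v by (intro exI[of _ "u + smult ((\<phi> y - poly u y) / poly v y) v"]) simp
qed simp

context norm_system
begin

text \<open>\<open>pt y\<close> stands for the point whose i-th coordinate is
  \<open>y ^ (q ^ i)\<close>; the coordinate 0 recovers \<open>y\<close>.\<close>

context
  fixes Y :: "'a set" and pt :: "'a \<Rightarrow> nat \<Rightarrow> 'a"
  assumes pt: "\<And>y. y \<in> Y \<Longrightarrow> pt y 0 = y"
    and sol: "\<And>y j. y \<in> Y \<Longrightarrow> j \<le> n \<Longrightarrow> linprod c {..<n} j (pt y) = \<gamma> j"
begin

text \<open>Multiplication by \<open>x 0\<close> leads into the larger staircase space. Decompose
  there and replace each product by its constant value \<open>\<gamma> j\<close> on the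
  solutions.\<close>

lemma stair_times_var:
  assumes w: "w \<in> polyfun (stair {..<n})"
  shows "\<exists>w'\<in>polyfun (stair {..<n}). \<forall>y\<in>Y. w' (pt y) = y * w (pt y)"
proof -
  have "(\<lambda>x. w x * poly [:0, 1:] (x 0)) \<in> polyfun (stair1 {..<n})"
    by (rule polyfun_mult_poly[OF w]) (use n in \<open>auto simp: stair_lessThan stair1_lessThan\<close>)
  then have "\<exists>r. (\<forall>j\<in>{..n}. r j \<in> polyfun (stair {..<n})) \<and>
      (\<lambda>x. w x * poly [:0, 1:] (x 0)) = (\<lambda>x. \<Sum>j\<in>{..n}. r j x * linprod c {..<n} j x)"
    using inj by (intro stair1_decomposition) auto
  then obtain r where r: "\<forall>j\<in>{..n}. r j \<in> polyfun (stair {..<n})"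
    "(\<lambda>x. w x * x 0) = (\<lambda>x. \<Sum>j\<le>n. r j x * linprod c {..<n} j x)"
    by auto
  have "(\<Sum>j\<le>n. \<gamma> j * r j (pt y)) = y * w (pt y)" if "y \<in> Y" for y
    using fun_cong[OF r(2), of "pt y"] sol[OF that] pt[OF that] by (simp add: mult.commute)
  moreover have "(\<lambda>x. \<Sum>j\<le>n. \<gamma> j * r j x) \<in> polyfun (stair {..<n})"
    using r(1) by (intro polyfun_sum polyfun_cmult) auto
  ultimately show ?thesis
    by (intro bexI[of _ "\<lambda>x. \<Sum>j\<le>n. \<gamma> j * r j x"]) auto
qed

text \<open>By Horner's scheme, constants and multiplication by \<open>y\<close> yield all
  polynomials in \<open>y\<close>, hence all functions on the finite set \<open>Y\<close>.\<close>

lemma stair_interpolates: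
  "\<exists>w\<in>polyfun (stair {..<n}). \<forall>y\<in>Y. w (pt y) = \<phi> y"
proof -
  have *: "\<exists>w\<in>polyfun (stair {..<n}). \<forall>y\<in>Y. w (pt y) = poly u y" for u
  proof (induction u)
    case 0
    show ?case by (intro bexI[of _ "\<lambda>x. 0"]) auto
  next
    case (pCons a u)
    then obtain w where w: "w \<in> polyfun (stair {..<n})" "\<forall>y\<in>Y. w (pt y) = poly u y" by blast
    obtain w' where "w' \<in> polyfun (stair {..<n})" "\<forall>y\<in>Y. w' (pt y) = y * w (pt y)"
      using stair_times_var[OF w(1)] by blast
    then show ?case
      using w(2) by (intro bexI[of _ "\<lambda>x. a + w' x"]) (auto intro: polyfun_add)
  qed
  obtain u where "\<forall>y\<in>Y. poly u y = \<phi> y"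
    using interpolating_poly[of Y \<phi>] by auto
  then show ?thesis
    using *[of u] by simp
qed

text \<open>
  Otherwise the sums of an element of the ideal, a multiple \<open>(\<mu> + \<nu> * x i) * eqn n x\<close> and an interpolating
  function would be pairwise distinct and more numerous than \<open>polyfun (stair1 {..<n})\<close>.
\<close>

lemma ideal_relation:
  assumes i: "1 \<le> i" "i < n" and Y: "fact n < card Y + 2"
  shows "\<exists>\<mu> \<nu> r. (\<mu>, \<nu>) \<noteq> (0, 0) \<and> (\<forall>j<n. r j \<in> polyfun (stair {..<n})) \<and>
      (\<forall>x. (\<mu> + \<nu> * x i) * eqn n x = (\<Sum>j<n. r j x * eqn j x))"
proof -
  define B B1 where "B = (polyfun (stair {..<n}) :: ((nat \<Rightarrow> 'a) \<Rightarrow> 'a) set)"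
    and "B1 = (polyfun (stair1 {..<n}) :: ((nat \<Rightarrow> 'a) \<Rightarrow> 'a) set)"
  have cardB: "finite B" "card B = CARD('a) ^ fact n" "finite B1" "card B1 = CARD('a) ^ fact (Suc n)"
    using card_polyfun_stair[where 'a = 'a, of "{..<n}"] n by (simp_all add: B_def B1_def)
  obtain w where w: "\<And>\<phi>. w \<phi> \<in> B" "\<And>\<phi> y. y \<in> Y \<Longrightarrow> w \<phi> (pt y) = \<phi> y"
    using stair_interpolates unfolding B_def by metis
  \<comment> \<open>\<open>card D\<close> has exponent \<open>n * fact n + 2 + card Y\<close>, which
    by the assumption exceeds \<open>fact (Suc n) = n * fact n + fact n\<close>.\<close>
  define D where "D = ({..<n} \<rightarrow>\<^sub>E B) \<times> (UNIV :: ('a \<times> 'a) set) \<times> (Y \<rightarrow>\<^sub>E (UNIV :: 'a set))"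
  define F where "F = (\<lambda>(r, (\<mu>, \<nu>), \<phi>) x. (\<Sum>j<n. r j x * eqn j x) + (\<mu> + \<nu> * x i) * eqn n x + w \<phi> x)"
  have "F ` D \<subseteq> B1"
  proof
    fix p assume "p \<in> F ` D"
    then obtain r \<mu> \<nu> \<phi> where r: "r \<in> {..<n} \<rightarrow>\<^sub>E B" and p: "p = F (r, (\<mu>, \<nu>), \<phi>)"
      by (auto simp: D_def)
    have "(\<lambda>x. \<Sum>j<n. r j x * eqn j x) \<in> B1"
      unfolding B1_def
    proof (rule polyfun_sum)
      fix j assume "j \<in> {..<n}"
      then have "r j \<in> polyfun (stair {..<n})" using r by (auto simp: B_def)
      then show "(\<lambda>x. r j x * eqn j x) \<in> polyfun (stair1 {..<n})"
        by (rule polyfun_mult'[OF _ eqn_polyfun]) (auto simp: stair_lessThan stair1_lessThan)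
    qed
    moreover have "(\<lambda>x. eqn n x * poly [:\<mu>, \<nu>:] (x i)) \<in> B1"
      unfolding B1_def
      by (rule polyfun_mult_poly[OF eqn_polyfun]) (use i in \<open>auto simp: stair1_lessThan\<close>)
    moreover have "w \<phi> \<in> B1"
      unfolding B1_def using w(1)[of \<phi>] stair_le_stair1 unfolding B_def by (rule polyfun_mono)
    ultimately have "(\<lambda>x. (\<Sum>j<n. r j x * eqn j x) + eqn n x * poly [:\<mu>, \<nu>:] (x i) + w \<phi> x) \<in> B1"
      unfolding B1_def by (intro polyfun_add)
    then show "p \<in> B1"
      by (simp add: p F_def mult.commute)
  qed
  then have "card (F ` D) \<le> card B1"
    using cardB(3) by (rule card_mono[rotated])
  also have "\<dots> < card D"
  proof -
    have "card D = CARD('a) ^ (n * fact n + (2 + card Y))"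
      using cardB by (simp add: D_def card_cartesian_product card_PiE power_add power2_eq_square mult.commute flip: power_mult)
    moreover have "fact (Suc n) < n * fact n + (2 + card Y)"
      using Y by simp
    moreover have "1 < CARD('a)"
      using n by simp
    ultimately show ?thesis
      unfolding cardB(4) by (simp only: power_strict_increasing)
  qed
  finally have "\<not> inj_on F D"
    by (rule pigeonhole)
  then obtain r \<mu> \<nu> \<phi> r' \<mu>' \<nu>' \<phi>' where
    D: "(r, (\<mu>, \<nu>), \<phi>) \<in> D" "(r', (\<mu>', \<nu>'), \<phi>') \<in> D" and
    ne: "(r, (\<mu>, \<nu>), \<phi>) \<noteq> (r', (\<mu>', \<nu>'), \<phi>')" and
    eq: "F (r, (\<mu>, \<nu>), \<phi>) = F (r', (\<mu>', \<nu>'), \<phi>')"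
    unfolding inj_on_def by (metis prod.collapse)
  have eq: "(\<Sum>j<n. r j x * eqn j x) + (\<mu> + \<nu> * x i) * eqn n x + w \<phi> x =
      (\<Sum>j<n. r' j x * eqn j x) + (\<mu>' + \<nu>' * x i) * eqn n x + w \<phi>' x" for x
    using fun_cong[OF eq, of x] by (simp add: F_def)
  \<comment> \<open>All \<open>n + 1\<close> equations vanish at \<open>pt y\<close>, so evaluation
    there leaves only the interpolating functions.\<close>
  have "\<phi> y = \<phi>' y" if "y \<in> Y" for y
    using eq[of "pt y"] sol[OF that] w(2)[OF that] by (simp add: eqn_def)
  then have \<phi>: "\<phi> = \<phi>'"
    using D by (intro PiE_ext[of \<phi> Y _ \<phi>']) (auto simp: D_def)
  define s where "s = (\<lambda>j x. r' j x - r j x)"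
  have s: "s j \<in> polyfun (stair {..<n})" if "j < n" for j
    unfolding s_def using D that by (intro polyfun_diff) (auto simp: D_def B_def)
  have rel: "((\<mu> - \<mu>') + (\<nu> - \<nu>') * x i) * eqn n x = (\<Sum>j<n. s j x * eqn j x)" for x
    using eq[of x] by (simp add: \<phi> s_def left_diff_distrib sum_subtractf algebra_simps)
  have "(\<mu> - \<mu>', \<nu> - \<nu>') \<noteq> (0, 0)"
  proof
    assume 0: "(\<mu> - \<mu>', \<nu> - \<nu>') = (0, 0)"
    then have "(\<Sum>j<n. s j x * eqn j x) = 0" for x
      using rel[of x] by simp
    then have "r j = r' j" if "j < n" for j
      using eqn_syzygy[of s j] s that by (simp add: s_def fun_eq_iff)
    then have "r = r'"
      using D by (intro PiE_ext[of r "{..<n}" _ r']) (auto simp: D_def)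
    then show False using ne 0 \<phi> by simp
  qed
  then show ?thesis
    using s rel by blast
qed

lemma eqn_dependent:
  assumes "fact n < card Y + 2"
  shows "\<exists>q. \<forall>x. eqn n x = (\<Sum>j<n. q j * eqn j x)"
  by (rule eqn_division[OF eqn_polyfun]) (rule ideal_relation[OF _ _ assms])

end

text \<open>
  Choosing \<open>x\<^sub>2, \<dots>, x\<^sub>n\<^sub>-\<^sub>1\<close> so that all products except those with index \<open>j\<close>, \<open>k\<close>, \<open>n\<close> vanish leaves a
  bilinear identity in \<open>x\<^sub>0\<close> and \<open>x\<^sub>1\<close>.
\<close>

lemma dependent_cross_ratio:
  assumes q: "\<And>x. eqn n x = (\<Sum>j<n. q j * eqn j x)" and jk: "j < n" "k < n"
  shows "(c 0 j - c 0 n) * (c 1 k - c 1 n) = (c 0 k - c 0 n) * (c 1 j - c 1 n)"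
proof (cases "j = k")
  case False
  \<comment> \<open>Each of the \<open>n - 2\<close> free coordinates kills one of the
    \<open>n - 2\<close> unwanted products; \<open>\<pi>\<close> is the assignment.\<close>
  have "card {2..<n} = card ({..<n} - {j, k})"
    using jk False n by (simp add: card_Diff_subset)
  then obtain \<pi> where \<pi>: "bij_betw \<pi> {2..<n} ({..<n} - {j, k})"
    using finite_same_card_bij[of "{2..<n}" "{..<n} - {j, k}"] by auto
  define M where "M = (\<lambda>l. \<Prod>i\<in>{2..<n}. c i l - c i (\<pi> i))"
  define z where "z = (\<lambda>s t i. if i = 0 then s else if i = 1 then t else - c i (\<pi> i))"
  have split: "{..<n} = {0, 1} \<union> {2..<n}"
    using n by auto
  have z: "linprod c {..<n} l (z s t) = (s + c 0 l) * (t + c 1 l) * M l" for s t l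
  proof -
    have "linprod c {..<n} l (z s t) = (s + c 0 l) * (t + c 1 l) * (\<Prod>i\<in>{2..<n}. z s t i + c i l)"
      unfolding linprod_def split by (subst prod.union_disjoint) (auto simp: z_def)
    moreover have "(\<Prod>i\<in>{2..<n}. z s t i + c i l) = M l"
      unfolding M_def by (intro prod.cong) (auto simp: z_def)
    ultimately show ?thesis by simp
  qed
  have M0: "M l = 0" if "l < n" "l \<noteq> j" "l \<noteq> k" for l
  proof -
    have "l \<in> \<pi> ` {2..<n}"
      using that bij_betw_imp_surj_on[OF \<pi>] by auto
    then show ?thesis
      by (auto simp: M_def)
  qed
  have Mn: "M n \<noteq> 0"
  proof -
    have "c i n \<noteq> c i (\<pi> i)" if "i \<in> {2..<n}" for i
      using inj_onD[OF inj[of i], of n "\<pi> i"] bij_betwE[OF \<pi>] that by fastforce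
    then show ?thesis by (simp add: M_def)
  qed
  define a b where "a = - (q j * M j)" and "b = - (q k * M k)"
  define \<delta> where "\<delta> = \<gamma> n - (\<Sum>l<n. q l * \<gamma> l)"
  have main: "(s + c 0 n) * (t + c 1 n) * M n + (s + c 0 j) * (t + c 1 j) * a + (s + c 0 k) * (t + c 1 k) * b = \<delta>" for s t
  proof -
    have "(s + c 0 n) * (t + c 1 n) * M n - \<gamma> n = (\<Sum>l<n. q l * ((s + c 0 l) * (t + c 1 l) * M l - \<gamma> l))"
      using q[of "z s t"] by (simp add: eqn_def z)
    also have "\<dots> = (\<Sum>l<n. q l * ((s + c 0 l) * (t + c 1 l) * M l)) - (\<Sum>l<n. q l * \<gamma> l)"
      by (simp add: right_diff_distrib sum_subtractf)
    also have "(\<Sum>l<n. q l * ((s + c 0 l) * (t + c 1 l) * M l)) = (\<Sum>l\<in>{j, k}. q l * ((s + c 0 l) * (t + c 1 l) * M l))"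
      using jk M0 by (intro sum.mono_neutral_right) auto
    finally show ?thesis
      using False by (simp add: a_def b_def \<delta>_def algebra_simps)
  qed
  define L where "L = (\<lambda>s t. (s + c 0 n) * (t + c 1 n) * M n + (s + c 0 j) * (t + c 1 j) * a + (s + c 0 k) * (t + c 1 k) * b)"
  have L: "L s t = \<delta>" for s t
    unfolding L_def by (rule main)
  \<comment> \<open>Differences of the constant function \<open>L\<close> at 0 and 1 isolate the
    coefficients of \<open>s * t\<close>, then of \<open>s\<close> and of \<open>t\<close>.\<close>
  have "M n + a + b = L 1 1 - L 1 0 - L 0 1 + L 0 0"
    by (simp add: L_def algebra_simps)
  then have sum0: "M n + a + b = 0"
    by (simp add: L)
  have "c 1 n * M n + c 1 j * a + c 1 k * b = L 1 0 - L 0 0"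
    by (simp add: L_def algebra_simps)
  then have sum1: "c 1 n * M n + c 1 j * a + c 1 k * b = 0"
    by (simp add: L)
  have "c 0 n * M n + c 0 j * a + c 0 k * b = L 0 1 - L 0 0"
    by (simp add: L_def algebra_simps)
  then have sum2: "c 0 n * M n + c 0 j * a + c 0 k * b = 0"
    by (simp add: L)
  have "a * (c 0 j - c 0 n) + b * (c 0 k - c 0 n) =
      (c 0 n * M n + c 0 j * a + c 0 k * b) - c 0 n * (M n + a + b)"
    by (simp add: algebra_simps)
  then have eq0: "a * (c 0 j - c 0 n) = - (b * (c 0 k - c 0 n))"
    unfolding sum0 sum2 by (simp add: eq_neg_iff_add_eq_0)
  have "a * (c 1 j - c 1 n) + b * (c 1 k - c 1 n) =
      (c 1 n * M n + c 1 j * a + c 1 k * b) - c 1 n * (M n + a + b)"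
    by (simp add: algebra_simps)
  then have eq1: "a * (c 1 j - c 1 n) = - (b * (c 1 k - c 1 n))"
    unfolding sum0 sum1 by (simp add: eq_neg_iff_add_eq_0)
  \<comment> \<open>If \<open>a = 0\<close>, then \<open>eq0\<close> forces \<open>b = 0\<close>,
    and \<open>sum0\<close> gives \<open>M n = 0\<close>.\<close>
  have "c 0 k - c 0 n \<noteq> 0"
    using inj_onD[OF inj[of 0], of k n] jk n by auto
  then have "a \<noteq> 0"
    using eq0 sum0 Mn by auto
  moreover have "a * ((c 0 j - c 0 n) * (c 1 k - c 1 n)) = a * ((c 0 k - c 0 n) * (c 1 j - c 1 n))"
  proof -
    have "a * ((c 0 j - c 0 n) * (c 1 k - c 1 n)) = a * (c 0 j - c 0 n) * (c 1 k - c 1 n)"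
      by (simp only: mult.assoc)
    also have "\<dots> = (c 0 k - c 0 n) * (- (b * (c 1 k - c 1 n)))"
      unfolding eq0 by (simp add: mult_ac)
    also have "\<dots> = a * ((c 0 k - c 0 n) * (c 1 j - c 1 n))"
      unfolding eq1[symmetric] by (simp only: mult_ac)
    finally show ?thesis .
  qed
  ultimately show ?thesis by simp
qed simp

end

section \<open>Norm equations over a finite field\<close>

locale frobenius =
  fixes q n :: nat and ty :: "'a::{field,finite} itself"
  assumes frob: "\<And>x y :: 'a. (x + y) ^ q = x ^ q + y ^ q"
    and q: "0 < q" and n: "3 \<le> n" "n < CARD('a)"
begin

lemma frob_iter: "(x + y :: 'a) ^ (q ^ i) = x ^ (q ^ i) + y ^ (q ^ i)"
proof (induction i)
  case (Suc i)
  have "(x + y) ^ (q ^ Suc i) = ((x + y) ^ (q ^ i)) ^ q"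
    by (simp add: mult.commute flip: power_mult)
  also have "\<dots> = x ^ (q ^ Suc i) + y ^ (q ^ Suc i)"
    by (simp add: Suc.IH frob mult.commute flip: power_mult)
  finally show ?case .
qed simp

lemma frob_diff: "(x - y :: 'a) ^ (q ^ i) = x ^ (q ^ i) - y ^ (q ^ i)"
  using frob_iter[of "x - y" y i] by (simp add: eq_diff_eq)

lemma frob_inj: "x ^ (q ^ i) = y ^ (q ^ i) \<longleftrightarrow> x = (y :: 'a)"
proof
  assume "x ^ (q ^ i) = y ^ (q ^ i)"
  then have "(x - y) ^ (q ^ i) = 0"
    by (simp add: frob_diff)
  then show "x = y" by simp
qed simp

definition nrm :: "'a \<Rightarrow> 'a" where
  "nrm x = (\<Prod>i<n. x ^ (q ^ i))"

lemma nrm_mult: "nrm (x * y) = nrm x * nrm y"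
  by (simp add: nrm_def power_mult_distrib prod.distrib)

lemma nrm_eq_0: "nrm x = 0 \<longleftrightarrow> x = 0"
  using n q by (auto simp: nrm_def intro: exI[of _ 0])

text \<open>
  If the shifts lie on an affine line over the fixed field of the Frobenius map, then the equations
  determine the characteristic polynomial of a solution, hence the solution up to conjugation.
\<close>

lemma card_solutions_line:
  assumes s: "inj_on s {..n}" "\<And>j. j \<le> n \<Longrightarrow> s j ^ q = s j"
    and Y: "\<And>y j. y \<in> Y \<Longrightarrow> j \<le> n \<Longrightarrow> nrm (y + s j) = \<gamma> j"
  shows "card Y \<le> n"
proof (cases "Y = {}")
  case False
  then obtain z where z: "z \<in> Y" by blast
  define \<chi> where "\<chi> = (\<lambda>y :: 'a. \<Prod>i<n. [:y ^ (q ^ i), 1:])"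
  have fixed: "s j ^ (q ^ i) = s j" if "j \<le> n" for i j
    by (induction i) (simp_all add: s(2)[OF that] power_mult)
  have eval: "poly (\<chi> y) (s j) = nrm (y + s j)" if "j \<le> n" for y j
    using that by (simp add: \<chi>_def nrm_def poly_prod frob_iter fixed)
  have deg: "degree (\<chi> y) < card (s ` {..n})" for y
    using degree_prod_sum_le[of "{..<n}" "\<lambda>i. [:y ^ (q ^ i), 1:]"]
    by (simp add: \<chi>_def card_image[OF s(1)] o_def)
  have "Y \<subseteq> (\<lambda>i. z ^ (q ^ i)) ` {..<n}"
  proof
    fix y assume y: "y \<in> Y"
    \<comment> \<open>Both have degree at most \<open>n\<close> and take the same values
      \<open>\<gamma> j\<close> at the \<open>n + 1\<close> points \<open>s j\<close>.\<close>
    have "\<chi> y = \<chi> z"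
      by (rule poly_eqI_degree[of "s ` {..n}", OF _ deg deg]) (use eval Y y z in auto)
    moreover have "poly (\<chi> y) (- y) = 0"
      using n by (auto simp: \<chi>_def poly_prod intro!: bexI[of _ 0])
    ultimately have "poly (\<chi> z) (- y) = 0"
      by simp
    then show "y \<in> (\<lambda>i. z ^ (q ^ i)) ` {..<n}"
      by (auto simp: \<chi>_def poly_prod)
  qed
  then have "card Y \<le> card ((\<lambda>i. z ^ (q ^ i)) ` {..<n})"
    by (intro card_mono) auto
  also have "\<dots> \<le> n"
    using card_image_le[of "{..<n}" "\<lambda>i. z ^ (q ^ i)"] by simp
  finally show ?thesis .
qed simp

lemma card_solutions:
  assumes c: "inj_on c {..n}"
    and Y: "\<And>y j. y \<in> Y \<Longrightarrow> j \<le> n \<Longrightarrow> nrm (y + c j) = \<gamma> j"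
  shows "card Y + 2 \<le> fact n"
proof (rule ccontr)
  assume "\<not> card Y + 2 \<le> fact n"
  then have big: "fact n < card Y + 2" by simp
  interpret norm_system n "\<lambda>i j. c j ^ (q ^ i)" \<gamma>
  proof
    show "inj_on (\<lambda>j. c j ^ (q ^ i)) {..n}" for i
      using c by (auto simp: inj_on_def frob_inj)
  qed (use n in auto)
  have "linprod (\<lambda>i j. c j ^ (q ^ i)) {..<n} j (\<lambda>i. y ^ (q ^ i)) = \<gamma> j" if "y \<in> Y" "j \<le> n" for y j
    using Y[OF that] by (simp add: linprod_def nrm_def frob_iter)
  then obtain p where p: "\<And>x. eqn n x = (\<Sum>j<n. p j * eqn j x)"
    using eqn_dependent[of Y "\<lambda>y i. y ^ (q ^ i)"] big by auto
  \<comment> \<open>The affine normalization sends the shifts to \<open>s 0 = 1\<close> and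
    \<open>s n = 0\<close>.\<close>
  define u where "u = c 0 - c n"
  have u: "u \<noteq> 0"
    using inj_onD[OF c, of 0 n] n by (auto simp: u_def)
  define s where "s = (\<lambda>j. (c j - c n) / u)"
  have cs: "c j = u * s j + c n" for j
    using u by (simp add: s_def)
  have "card ((\<lambda>y. (y + c n) / u) ` Y) \<le> n"
  proof (rule card_solutions_line)
    show "inj_on s {..n}"
      using c u by (auto simp: inj_on_def s_def)
    show "s j ^ q = s j" if "j \<le> n" for j
    proof (cases "j = n")
      case True
      then show ?thesis using q by (simp add: s_def)
    next
      \<comment> \<open>In the cross ratio identity with \<open>k = 0\<close>, the row 0 holds the
        shifts and the row 1 their q-th powers.\<close>
      case False
      then have "(c j - c n) * u ^ q = u * (c j - c n) ^ q"
        using dependent_cross_ratio[OF p, of j 0] that n frob_diff[of _ _ 1] by (simp add: u_def)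
      then show ?thesis
        using u by (simp add: s_def power_divide field_simps)
    qed
    fix z j assume "z \<in> (\<lambda>y. (y + c n) / u) ` Y" "j \<le> n"
    then obtain y where y: "y \<in> Y" "z = (y + c n) / u" by blast
    then have "y + c j = u * (z + s j)"
      using u cs[of j] by (simp add: field_simps)
    then have "nrm u * nrm (z + s j) = \<gamma> j"
      using Y[OF y(1) \<open>j \<le> n\<close>] nrm_mult[of u "z + s j"] by simp
    then show "nrm (z + s j) = \<gamma> j / nrm u"
      using u nrm_eq_0[of u] by (simp add: eq_divide_eq mult.commute)
  qed
  moreover have "inj_on (\<lambda>y. (y + c n) / u) Y"
    using u by (auto simp: inj_on_def)
  ultimately have "card Y \<le> n"
    by (simp add: card_image)
  moreover have "n * 2 \<le> fact n"
  proof -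
    obtain m where m: "n = Suc (Suc m)" "1 \<le> m"
      using n(1) by (metis One_nat_def Suc_le_D Suc_le_mono numeral_3_eq_3)
    have "1 * 2 \<le> fact m * Suc m"
      by (rule mult_le_mono) (use m in auto)
    then show ?thesis
      unfolding m(1) fact_Suc of_nat_id using m(1) by (intro mult_le_mono) (auto simp: mult.commute)
  qed
  ultimately show False
    using big n(1) by linarith
qed

end

section \<open>From the norm graph to norm equations\<close>

lemma frobenius_additive:
  fixes x y :: "'a::{field,finite}"
  assumes "primepow q" "CARD('a) = q ^ m"
  shows "(x + y) ^ q = x ^ q + y ^ q"
proof -
  obtain p k where p: "prime p" "q = p ^ k"
    using assms(1) by (auto simp: primepow_def)
  have "prime CHAR('a)"
    using finite_imp_CHAR_pos[where 'a = 'a] by (intro prime_CHAR_semidom) auto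
  moreover have "CHAR('a) dvd (p ^ k) ^ m"
    using CHAR_dvd_CARD[where 'a = 'a] assms(2) p(2) by simp
  ultimately have "CHAR('a) = p"
    using p(1) by (metis prime_dvd_power primes_dvd_imp_eq)
  then show ?thesis
    using freshmans_dream'[OF \<open>prime CHAR('a)\<close>, of q k x y] p(2) by simp
qed

theorem theorem2p6:
  fixes F :: "'a::{field,finite} set" and q t :: nat
  assumes "4 \<le> t"
    and "primepow q"
    and "CARD('a) = q ^ (t - 1)"
    and "subfield F (ring_of_type_algebra :: 'a ring)"
    and "card F = q"
    and "q \<ge> fact (t - 1) + 1"
  shows "\<not> contains_complete_bipartite (t + 1) (fact (t - 1) - 1) (norm_graph F q t)"
proof
  define n where "n = t - 1"
  have t: "t = Suc n" "3 \<le> n" using assms(1) by (auto simp: n_def)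
  have q: "1 < q" using assms(2) by (rule primepow_gt_Suc_0[unfolded One_nat_def[symmetric]])
  interpret frobenius q n "TYPE('a)"
  proof
    show "(x + y) ^ q = x ^ q + y ^ q" for x y :: 'a
      by (rule frobenius_additive[OF assms(2,3)])
    have "n < 2 ^ n" by simp
    also have "\<dots> \<le> q ^ n" using q by (intro power_mono) auto
    finally show "n < CARD('a)" using assms(3) by (simp add: n_def)
  qed (use q t in auto)
  have nrm: "norm_map q t x = nrm x" for x :: 'a
    by (simp only: norm_map_def nrm_def power_sum t(1) diff_Suc_1)
  assume "contains_complete_bipartite (t + 1) (fact (t - 1) - 1) (norm_graph F q t)"
  then obtain A B where AB: "finite A" "finite B" "card A = n + 2" "card B = fact n - 1"
    "A \<times> B \<subseteq> parcs (norm_graph F q t)"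
    unfolding contains_complete_bipartite_iff[OF wf_norm_graph sym_norm_graph] by (auto simp: t(1))
  have adj: "\<alpha> \<noteq> 0 \<and> \<beta> \<noteq> 0 \<and> nrm (a + b) = \<alpha> * \<beta>" if "(a, \<alpha>) \<in> A" "(b, \<beta>) \<in> B" for a \<alpha> b \<beta>
    using AB(5) that by (auto simp: norm_graph_def nrm)
  \<comment> \<open>This makes the subtraction in \<open>fact n - 1\<close> genuine and provides a
    common neighbour.\<close>
  have "(6::nat) \<le> fact n"
    using fact_mono[OF t(2)] by (simp add: fact_numeral)
  then have "B \<noteq> {}" using AB(4) by auto
  then obtain b0 \<beta>0 where b0: "(b0, \<beta>0) \<in> B" by auto
  \<comment> \<open>A common neighbour determines \<open>\<alpha>\<close> from \<open>a\<close>,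
    because \<open>\<beta>0\<close> is nonzero; hence the vertices in \<open>A\<close> have distinct
    first coordinates.\<close>
  have injA: "\<alpha> = \<alpha>'" if "(a, \<alpha>) \<in> A" "(a, \<alpha>') \<in> A" for a \<alpha> \<alpha>'
    using adj[OF that(1) b0] adj[OF that(2) b0] by simp
  have "A \<noteq> {}" using AB(3) by auto
  then obtain a0 \<alpha>0 where a0: "(a0, \<alpha>0) \<in> A" by auto
  have "card (A - {(a0, \<alpha>0)}) = card {..n}"
    using AB(1,3) a0 by simp
  then obtain v where v: "bij_betw v {..n} (A - {(a0, \<alpha>0)})"
    using AB(1) finite_same_card_bij[of "{..n}" "A - {(a0, \<alpha>0)}"] by auto
  define a \<alpha> where "a = (\<lambda>j. fst (v j))" and "\<alpha> = (\<lambda>j. snd (v j))"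
  have vA: "(a j, \<alpha> j) \<in> A" "(a j, \<alpha> j) \<noteq> (a0, \<alpha>0)" if "j \<le> n" for j
    using bij_betwE[OF v] that by (auto simp: a_def \<alpha>_def)
  have ne: "a j \<noteq> a0" if "j \<le> n" for j
    using injA[of a0 "\<alpha> j" \<alpha>0] vA[OF that] a0 by auto
  have inj: "inj_on a {..n}"
  proof (rule inj_onI)
    fix j k assume jk: "j \<in> {..n}" "k \<in> {..n}" "a j = a k"
    then have "\<alpha> j = \<alpha> k"
      using injA[of "a j" "\<alpha> j" "\<alpha> k"] vA(1)[of j] vA(1)[of k] by auto
    then have "v j = v k"
      using jk(3) by (simp add: a_def \<alpha>_def prod_eq_iff)
    then show "j = k"
      using bij_betw_imp_inj_on[OF v] jk by (auto dest: inj_onD)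
  qed
  \<comment> \<open>Since \<open>1 / (b + a0) + 1 / (a j - a0) = (a j + b) / ((b + a0) * (a j -
    a0))\<close>, taking norms cancels \<open>\<beta>\<close> and makes the right-hand side
    independent of the neighbour.\<close>
  define c where "c = (\<lambda>j. 1 / (a j - a0))"
  define Y where "Y = (\<lambda>(b, \<beta>). 1 / (b + a0)) ` B"
  have nz: "b + a0 \<noteq> 0" if "(b, \<beta>) \<in> B" for b \<beta>
    using adj[OF a0 that] nrm_eq_0[of "a0 + b"] by (auto simp: add.commute)
  have "card Y + 2 \<le> fact n"
  proof (rule card_solutions)
    show "inj_on c {..n}"
    proof (rule inj_onI)
      fix j k assume jk: "j \<in> {..n}" "k \<in> {..n}" "c j = c k"
      then have "a j = a k" by (simp add: c_def)
      then show "j = k" using inj jk by (auto dest: inj_onD)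
    qed
    fix y j assume "y \<in> Y" and j: "j \<le> n"
    then obtain b \<beta> where b: "(b, \<beta>) \<in> B" "y = 1 / (b + a0)" by (auto simp: Y_def)
    have "(1 / u + 1 / w) * (u * w) = w + u" if "u \<noteq> 0" "w \<noteq> 0" for u w :: 'a
      using that by (simp add: field_simps)
    from this[of "b + a0" "a j - a0"] have "(y + c j) * ((a0 + b) * (a j - a0)) = a j + b"
      using nz[OF b(1)] ne[OF j] by (simp add: b(2) c_def add.commute)
    then have "nrm (y + c j) * (nrm (a0 + b) * nrm (a j - a0)) = nrm (a j + b)"
      by (metis nrm_mult)
    then have "nrm (y + c j) * (\<alpha>0 * \<beta> * nrm (a j - a0)) = \<alpha> j * \<beta>"
      using adj[OF a0 b(1)] adj[OF vA(1)[OF j] b(1)] by simp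
    then show "nrm (y + c j) = \<alpha> j / (\<alpha>0 * nrm (a j - a0))"
      using adj[OF a0 b(1)] ne[OF j] by (simp add: field_simps nrm_eq_0)
  qed
  \<comment> \<open>Equal values give equal \<open>b\<close>, and then adjacency to
    \<open>(a0, \<alpha>0)\<close> determines \<open>\<beta>\<close>.\<close>
  moreover have "card Y = card B"
    unfolding Y_def
  proof (rule card_image, rule inj_onI, clarify)
    fix b \<beta> b' \<beta>' assume b: "(b, \<beta>) \<in> B" "(b', \<beta>') \<in> B" "1 / (b + a0) = 1 / (b' + a0)"
    then have "b = b'" by simp
    then show "b = b' \<and> \<beta> = \<beta>'"
      using adj[OF a0 b(1)] adj[OF a0 b(2)] by simp
  qed
  ultimately show False
    using AB(4) \<open>6 \<le> fact n\<close> by simp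
qed

end
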